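(* Let $H$ be a length-factorial Krull monoid that is not factorial, and let $H^*$, $G_{P^*}$, $t$, $k$, $s_0,\ldots,s_t$, $e_{i,j}$, $g_i$ be as described in the context, with $e_{i,0}=g_i$ for $i\in[0,k]$. 1. The inclusion $\mathcal B (G_{P^*}) \hookrightarrow \mathcal F (G_{P^*})$ is a divisor theory with class group isomorphic to $\mathcal C (H)$. The set of atoms of $\mathcal B(G_{P^*})$ is $\mathcal A (G_{P^*}) = \{U_0,\ldots, U_k, V_0,\ldots, V_t\}$ where, for every $i\in [0,k]$ and every $j\in [1,t]$, \[ U_0=g_0^{s_0}e_{0,1}^{s_1} \cdot \ldots \cdot e_{0,t}^{s_t}, \quad U_i=e_{i,0}^{s_0} \cdot \ldots \cdot e_{i,t}^{s_t}, \quad V_0=g_0 \cdot \ldots \cdot g_k, \quad V_j=e_{0,j} \cdot \ldots \cdot e_{k,j}, \] and $U_0 \cdot \ldots \cdot U_k=V_0^{s_0} \cdot \ldots \cdot V_t^{s_t}$. 2. Every $B\in \mathcal B(G_{P^*})$ can be written uniquely in the form \[ B =(U_0 \cdot \ldots \cdot U_k)^x\ \prod_{i=0}^kU_i^{y_i} \ \prod_{j=0}^tV_j^{z_j}, \] where $x, y_0,\ldots, y_k, z_0,\ldots,z_t \in \mathbb N_0$, $y_i=0$ for some $i\in [0,k]$, and $z_j<s_j$ for some $j\in [0,t]$. Furthermore, we have \[ \mathsf L(B) =\sum_{i=0}^ky_i + \sum_{j=0}^t z_j + \Big\{\nu (k+1)+(x-\nu)\sum_{j=0}^ts_j\colon \nu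 \in [0,x] \Big\}. \] 3. For the system of sets of lengths $\mathcal L (H)$, we have \[ \mathcal L(H)= \Big\{ \big\{y+ \nu (k+1)+(x-\nu)\sum_{j=0}^ts_j\colon \nu \in [0,x] \big\} \colon y,x\in \mathbb N_0 \Big\}. \] In particular, the system $\mathcal L (H)$ is additively closed with respect to set addition as operation, i.e. $L_1+L_2\in\mathcal L(H)$ for all $L_1,L_2\in\mathcal L(H)$.
   Context: A monoid means a commutative semigroup with identity that is unit-cancellative ($a=au$ implies that $u$ is invertible). $\mathbb N=\{1,2,\ldots\}$, $\mathbb N_0=\mathbb N\cup\{0\}$, $[a,b]=\{x\in\mathbb Z: a\le x\le b\}$. For $A,B\subset\mathbb Z$, $A+B=\{a+b: a\in A,b\in B\}$, and $m+A=\{m\}+A$. For a monoid $H$: $H^\times$ is its group of invertible elements; $H$ is reduced if $H^\times=\{1\}$; $H_{\mathrm{red}}=\{aH^\times : a\in H\}$. An element $u\notin H^\times$ is prime if $u\mid ab$ implies $u\mid a$ or $u\mid b$; it is an atom if $u=ab$ implies $a\in H^\times$ or $b\in H^\times$. $\mathcal F(P)$ is the free abelian monoid with basis $P$. The factorization monoid is $\mathsf Z(H)=\mathcal F(\mathcal A(H_{\mathrm{red}}))$, where $\mathcal A(\cdot)$ is the set of atoms. Factorizations of $a\in H$ are the $z\in\mathsf Z(H)$ with product $aH^\times$ in $H_{\mathrm{red}}$; the length $|z|$ is the number of atoms counted with multiplicity. $\mathsf L(a)=\mathsf L_H(a)\subset\mathbb N_0$ is the set of lengths of factorizations of $a$,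 and $\mathcal L(H)=\{\mathsf L(a):a\in H\}$. $H$ is atomic if every element has a factorization, factorial if every element has exactly one, and length-factorial if it is atomic and any two distinct factorizations of any element have distinct lengths. A monoid homomorphism $\varphi\colon H\to D$ is a divisor homomorphism if $\varphi(a)\mid\varphi(b)$ in $D$ implies $a\mid b$ in $H$. It is a divisor theory if moreover $D$ is free abelian and every $a\in D$ is of the form $\gcd(\varphi(a_1),\ldots,\varphi(a_m))$ with $a_1,\ldots,a_m\in H$. A Krull monoid is a cancellative monoid having a divisor theory. If $H$ is Krull with divisor theory $H_{\mathrm{red}}\hookrightarrow F=\mathcal F(P)$ (unique up to isomorphism), the class group is $\mathcal C(H)=\mathsf q(F)/\mathsf q(H_{\mathrm{red}})$ (quotient groups), written additively. The elements of $P$ are the prime divisors, and $p\in P$ lies in the class $[p]=p\,\mathsf q(H_{\mathrm{red}})$. If $\mathcal B\hookrightarrow\mathcal F$ is a divisor theory of a reduced monoid, its class group is $\mathsf q(\mathcal F)/\mathsf q(\mathcal B)$. For an additive abelian group $G$ and $G_0\subset G$: $\langle G_0\rangle$ is the subgroup generated by $G_0$. Elements $e_1,\ldots,e_r$ are independent if all are nonzero and $\langle e_1,\ldots,e_r\rangle=\langle e_1\rangle\oplus\ldots\oplus\langle e_r\rangle$. $\mathcal B(G_0)=\{S=g_1\cdot\ldots\cdot g_\ell\in\mathcal F(G_0): g_1+\ldots+g_\ell=0\}$ is the monoid of zero-sum sequences over $G_0$, and $\mathcal A(G_0)$ is its set of atoms. Setting (structure of a length-factorial, non-factorial Krull monoid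 $H$): $H=H^\times\times\mathcal F(P_0)\times H^*$, where $P_0$ is a set of representatives of the prime elements of $H$ and $H^*$ is a reduced Krull monoid without primes, with $\mathcal C(H^* )\cong\mathcal C(H)$. $G_{P^*}\subset\mathcal C(H^* )$ is the set of classes containing prime divisors; every class of $G_{P^*}$ contains precisely one prime divisor, and $H^*\cong\mathcal B(G_{P^*})$. There are $t\in\mathbb N_0$, $k,s_0,\ldots,s_t\in\mathbb N$ with $k+1\ne s_0+\ldots+s_t\ge 2$, independent elements $e_{i,j}\in\mathcal C(H^* )$ ($i\in[1,k]$, $j\in[1,t]$) of infinite order, and independent elements $g_1,\ldots,g_k\in\mathcal C(H^* )$, of infinite order if $t>0$ and of finite order if $t=0$, such that: (i) for every $i\in[1,k]$, $s_0$ is the smallest positive integer with $s_0g_i\in\langle e_{i,1},\ldots,e_{i,t}\rangle$, and $-s_0g_i=s_1e_{i,1}+\ldots+s_te_{i,t}$; (ii) $e_{0,j}=-\sum_{i=1}^k e_{i,j}$ for $j\in[1,t]$, $g_0=-\sum_{i=1}^k g_i$, and $n=\gcd(s_0,\ldots,s_t)$; (iii) $G_{P^*}=\{e_{i,j}: i\in[0,k], j\in[1,t]\}\cup\{g_0,\ldots,g_k\}$; (iv) $\mathcal C(H^* )=\bigoplus_{i=1}^k\langle e_{i,1},\ldots,e_{i,t},g_i\rangle\cong(\mathbb Z^t\oplus\mathbb Z/n\mathbb Z)^k$. *)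

theory Defs
  imports "HOL-Algebra.Algebra" "HOL-Library.Multiset"
begin

text \<open>
  Monoids are HOL-Algebra structures, written multiplicatively. Krull monoids are cancellative, so
  unit-cancellativity is subsumed by \<^locale>\<open>comm_monoid_cancel\<close>. Class groups, which are usually
  written additively, are multiplicative here: the zero element is \<^term>\<open>\<one>\<^bsub>C\<^esub>\<close>, the negative of
  \<^term>\<open>g\<close> is \<^term>\<open>inv\<^bsub>C\<^esub> g\<close>, and the multiple of \<^term>\<open>g\<close> by \<^term>\<open>n\<close> is \<^term>\<open>g [^]\<^bsub>C\<^esub> (n :: nat)\<close>.
\<close>

definition free_monoid :: "'a set \<Rightarrow> 'a multiset monoid" where
  "free_monoid P = \<lparr>carrier = {z. set_mset z \<subseteq> P}, monoid.mult = (+), one = {#}\<rparr>"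

definition mset_prod :: "('a, 'm) monoid_scheme \<Rightarrow> 'a multiset \<Rightarrow> 'a" where
  "mset_prod G z = finprod G (\<lambda>u. u [^]\<^bsub>G\<^esub> count z u) (set_mset z)"

definition reduced :: "('a, 'm) monoid_scheme \<Rightarrow> bool" where
  "reduced G \<longleftrightarrow> Units G = {\<one>\<^bsub>G\<^esub>}"

definition red_monoid :: "('a, 'm) monoid_scheme \<Rightarrow> 'a set monoid" where
  "red_monoid G =
    \<lparr>carrier = (\<lambda>a. a <#\<^bsub>G\<^esub> Units G) ` carrier G, monoid.mult = set_mult G, one = Units G\<rparr>"

definition atoms :: "('a, 'm) monoid_scheme \<Rightarrow> 'a set" where
  "atoms G = {u \<in> carrier G. Divisibility.irreducible G u}"

lemma (in comm_monoid_cancel) atoms_alt_def: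
  "atoms G = {u \<in> carrier G. u \<notin> Units G \<and>
     (\<forall>a\<in>carrier G. \<forall>b\<in>carrier G. u = a \<otimes> b \<longrightarrow> a \<in> Units G \<or> b \<in> Units G)}"
proof -
  have "Divisibility.irreducible G u \<longleftrightarrow> u \<notin> Units G \<and>
      (\<forall>a\<in>carrier G. \<forall>b\<in>carrier G. u = a \<otimes> b \<longrightarrow> a \<in> Units G \<or> b \<in> Units G)"
    (is "?L \<longleftrightarrow> ?R") if u: "u \<in> carrier G" for u
  proof
    assume L: ?L
    have "a \<in> Units G \<or> b \<in> Units G"
      if "a \<in> carrier G" "b \<in> carrier G" "u = a \<otimes> b" for a b
      using irreducible_prodE[of a b] L that by metis
    with L show ?R by (auto simp: irreducible_def)
  next
    assume R: ?R
    show ?L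
    proof (rule irreducibleI)
      show "u \<notin> Units G" using R by blast
      fix b assume b: "b \<in> carrier G" and pf: "properfactor G b u"
      then obtain c where c: "c \<in> carrier G" "u = b \<otimes> c"
        by (auto simp: properfactor_def factor_def)
      have "c \<notin> Units G"
      proof
        assume "c \<in> Units G"
        with b c have "b = u \<otimes> inv c" by (simp add: m_assoc)
        with \<open>c \<in> Units G\<close> have "u divides b" by (auto simp: factor_def)
        with pf show False by (simp add: properfactor_def)
      qed
      with R b c show "b \<in> Units G" by blast
    qed
  qed
  then show ?thesis by (auto simp: atoms_def)
qed

definition factorizations :: "('a, 'm) monoid_scheme \<Rightarrow> 'a \<Rightarrow> 'a set multiset set" where
  "factorizations G a =
    {z \<in> carrier (free_monoid (atoms (red_monoid G))).
       mset_prod (red_monoid G) z = a <#\<^bsub>G\<^esub> Units G}"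

definition length_set :: "('a, 'm) monoid_scheme \<Rightarrow> 'a \<Rightarrow> nat set" where
  "length_set G a = size ` factorizations G a"

definition length_system :: "('a, 'm) monoid_scheme \<Rightarrow> nat set set" where
  "length_system G = length_set G ` carrier G"

definition atomic :: "('a, 'm) monoid_scheme \<Rightarrow> bool" where
  "atomic G \<longleftrightarrow> (\<forall>a\<in>carrier G. factorizations G a \<noteq> {})"

definition length_factorial :: "('a, 'm) monoid_scheme \<Rightarrow> bool" where
  "length_factorial G \<longleftrightarrow> atomic G \<and> (\<forall>a\<in>carrier G. inj_on size (factorizations G a))"

definition divisor_hom ::
    "('a, 'm) monoid_scheme \<Rightarrow> ('b, 'n) monoid_scheme \<Rightarrow> ('a \<Rightarrow> 'b) \<Rightarrow> bool" where
  "divisor_hom H D \<phi> \<longleftrightarrow> \<phi> \<in> hom H D \<and> \<phi> \<one>\<^bsub>H\<^esub> = \<one>\<^bsub>D\<^esub> \<and>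
    (\<forall>a\<in>carrier H. \<forall>b\<in>carrier H. \<phi> a divides\<^bsub>D\<^esub> \<phi> b \<longrightarrow> a divides\<^bsub>H\<^esub> b)"

text \<open>
  The free abelian target with basis \<^term>\<open>P\<close> is always taken to be \<^term>\<open>free_monoid P\<close>. The last
  clause says that \<^term>\<open>d\<close> is a greatest common divisor of the elements of \<^term>\<open>\<phi> ` A\<close>.
\<close>

definition divisor_theory ::
    "('a, 'm) monoid_scheme \<Rightarrow> 'p set \<Rightarrow> ('a \<Rightarrow> 'p multiset) \<Rightarrow> bool" where
  "divisor_theory H P \<phi> \<longleftrightarrow> divisor_hom H (free_monoid P) \<phi> \<and>
    (\<forall>d\<in>carrier (free_monoid P). \<exists>A\<subseteq>carrier H. finite A \<and> A \<noteq> {} \<and>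
       greatest (division_rel (free_monoid P)) d (Lower (division_rel (free_monoid P)) (\<phi> ` A)))"

text \<open>
  The basis is sought among the sets of subsets of the monoid. This is no restriction: in a divisor
  theory every basis element \<open>p\<close> is the greatest common divisor of the images of the elements of
  some finite set, and this finite set determines \<open>p\<close>, so any basis can be relabelled by subsets.
\<close>

definition krull_monoid :: "('a, 'm) monoid_scheme \<Rightarrow> bool" where
  "krull_monoid H \<longleftrightarrow>
    comm_monoid_cancel H \<and> (\<exists>(P :: 'a set set) \<phi>. divisor_theory H P \<phi>)"

text \<open>The quotient group of a cancellative monoid: the class of \<open>(a, b)\<close> is the fraction \<open>a / b\<close>.\<close>

definition frac_rel :: "('a, 'm) monoid_scheme \<Rightarrow> (('a \<times> 'a) \<times> ('a \<times> 'a)) set" where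
  "frac_rel M = {((a, b), (c, d)). a \<in> carrier M \<and> b \<in> carrier M \<and> c \<in> carrier M \<and>
     d \<in> carrier M \<and> a \<otimes>\<^bsub>M\<^esub> d = c \<otimes>\<^bsub>M\<^esub> b}"

definition fraction :: "('a, 'm) monoid_scheme \<Rightarrow> 'a \<Rightarrow> 'a \<Rightarrow> ('a \<times> 'a) set" where
  "fraction M a b = frac_rel M `` {(a, b)}"

definition quotient_group :: "('a, 'm) monoid_scheme \<Rightarrow> ('a \<times> 'a) set monoid" where
  "quotient_group M =
    \<lparr>carrier = (carrier M \<times> carrier M) // frac_rel M,
     monoid.mult = (\<lambda>A B. \<Union>x\<in>A. \<Union>y\<in>B. fraction M (fst x \<otimes>\<^bsub>M\<^esub> fst y) (snd x \<otimes>\<^bsub>M\<^esub> snd y)),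
     one = fraction M \<one>\<^bsub>M\<^esub> \<one>\<^bsub>M\<^esub>\<rparr>"

text \<open>
  For a divisor theory \<^term>\<open>\<phi>\<close> of a reduced monoid \<^term>\<open>M\<close> into the free abelian monoid
  with basis \<^term>\<open>P\<close>, the following is the quotient group of \<^term>\<open>M\<close> as a subgroup
  of the quotient group of the free abelian monoid.
\<close>

definition quotient_subgroup ::
    "('a, 'm) monoid_scheme \<Rightarrow> 'p set \<Rightarrow> ('a \<Rightarrow> 'p multiset) \<Rightarrow> ('p multiset \<times> 'p multiset) set set"
  where "quotient_subgroup M P \<phi> =
    {fraction (free_monoid P) (\<phi> a) (\<phi> b) | a b. a \<in> carrier M \<and> b \<in> carrier M}"

definition class_group ::
    "('a, 'm) monoid_scheme \<Rightarrow> 'p set \<Rightarrow> ('a \<Rightarrow> 'p multiset)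
      \<Rightarrow> ('p multiset \<times> 'p multiset) set set monoid" where
  "class_group M P \<phi> = quotient_group (free_monoid P) Mod quotient_subgroup M P \<phi>"

definition prime_divisor_class ::
    "('a, 'm) monoid_scheme \<Rightarrow> 'p set \<Rightarrow> ('a \<Rightarrow> 'p multiset) \<Rightarrow> 'p
      \<Rightarrow> ('p multiset \<times> 'p multiset) set set" where
  "prime_divisor_class M P \<phi> p =
    quotient_subgroup M P \<phi> #>\<^bsub>quotient_group (free_monoid P)\<^esub> fraction (free_monoid P) {#p#} {#}"

definition internal_direct_sum ::
    "('a, 'm) monoid_scheme \<Rightarrow> 'i set \<Rightarrow> ('i \<Rightarrow> ('a, 'n) monoid_scheme) \<Rightarrow> bool" where
  "internal_direct_sum G I A \<longleftrightarrow> (\<lambda>x. finprod G x I) \<in> iso (sum_group I A) G"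

definition independent_family ::
    "('a, 'm) monoid_scheme \<Rightarrow> 'i set \<Rightarrow> ('i \<Rightarrow> 'a) \<Rightarrow> bool" where
  "independent_family G I x \<longleftrightarrow> (\<forall>i\<in>I. x i \<in> carrier G \<and> x i \<noteq> \<one>\<^bsub>G\<^esub>) \<and>
    internal_direct_sum (subgroup_generated G (x ` I)) I (\<lambda>i. subgroup_generated G {x i})"

definition zero_sum_monoid :: "('a, 'm) monoid_scheme \<Rightarrow> 'a set \<Rightarrow> 'a multiset monoid" where
  "zero_sum_monoid G G\<^sub>0 = (free_monoid G\<^sub>0)
    \<lparr>carrier := {S \<in> carrier (free_monoid G\<^sub>0). mset_prod G S = \<one>\<^bsub>G\<^esub>}\<rparr>"

end

theory Submission
  imports Defs
begin

text \<open>
  A sequence over the classes \<open>e i j\<close> is a matrix of multiplicities. Directness of the sum, minimality of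
  \<open>s 0\<close> and independence of the \<open>e i j\<close> together say that a matrix is zero-sum exactly when any two of its
  rows differ by an integer multiple of \<open>(s 0, \<dots>, s t)\<close>, i.e. when its entries have the shape
  \<open>a j + c i * s j\<close>; the condition \<open>k + 1 \<noteq> \<Sum> s j\<close> is what makes the classes \<open>e i j\<close> pairwise distinct.
  Subtracting the row with least \<open>c i\<close> writes such a matrix as a combination \<open>\<Sum> \<alpha> i U i + \<Sum> \<beta> j V j\<close>,
  and two combinations agree exactly when they differ by a multiple of the relation
  \<open>\<Sum> U i = \<Sum> s j V j\<close>. Atoms, normal forms and sets of lengths are read off from this.
\<close>

section \<open>Products of multisets and reduced monoids\<close>

text \<open>Two translations carry the proof. Lengths are defined through the reduced monoid of
  \<open>H\<close>, whereas matrices describe zero-sum sequences over \<open>G'\<close>. The passage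
  goes through \<open>atom_prods\<close>, which moves along isomorphisms and splits over direct
  products. Units contribute no length and a multiset \<open>z\<close> of primes contributes exactly
  \<open>size z\<close>, so \<open>length_system H\<close> consists of translates of the sets of
  lengths of zero-sum sequences. The other translation turns relations in \<open>C\<close> into the
  matrix shape. Row 0 is minus the sum of the other rows; eliminating it leaves the differences
  \<open>m i j - m 0 j\<close>, directness isolates each row \<open>i \<ge> 1\<close>, and division
  by \<open>s 0\<close> with remainder settles a single row. The case \<open>t = 0\<close> runs
  along: the subgroup generated by the empty set is trivial, and the conditions on
  \<open>s 0\<close> say that it is the order of \<open>g i\<close>. Afterwards the group is gone,
  and the locale \<open>grid\<close> sees multiplicities only.\<close>

lemma (in comm_monoid) mset_prod_eq_finprod:
  assumes "finite A" "set_mset z \<subseteq> A" "A \<subseteq> carrier G"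
  shows "mset_prod G z = finprod G (\<lambda>u. u [^] count z u) A"
proof -
  have "finprod G (\<lambda>u. u [^] count z u) (set_mset z \<union> (A - set_mset z)) =
      finprod G (\<lambda>u. u [^] count z u) (set_mset z) \<otimes> finprod G (\<lambda>u. u [^] count z u) (A - set_mset z)"
    using assms by (intro finprod_Un_disjoint) (auto simp: subset_iff)
  also have "finprod G (\<lambda>u. u [^] count z u) (A - set_mset z) = \<one>"
    using assms by (intro finprod_one_eqI) (auto simp: not_in_iff)
  also have "set_mset z \<union> (A - set_mset z) = A"
    using assms by auto
  finally show ?thesis
    using assms by (subst (asm) r_one) (auto simp: mset_prod_def subset_iff intro!: finprod_closed)
qed

lemma (in comm_monoid) mset_prod_closed:
  "set_mset z \<subseteq> carrier G \<Longrightarrow> mset_prod G z \<in> carrier G"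
  by (auto simp: mset_prod_def subset_iff intro!: finprod_closed)

lemma (in comm_monoid) mset_prod_empty [simp]: "mset_prod G {#} = \<one>"
  by (simp add: mset_prod_def)

text \<open>The supports of \<open>y\<close> and \<open>z\<close> may differ, so all three products
  are first spread over the union of the supports, where absent elements get exponent 0.\<close>

lemma (in comm_monoid) mset_prod_union:
  assumes "set_mset y \<subseteq> carrier G" "set_mset z \<subseteq> carrier G"
  shows "mset_prod G (y + z) = mset_prod G y \<otimes> mset_prod G z"
proof -
  let ?A = "set_mset y \<union> set_mset z"
  have A: "finite ?A" "?A \<subseteq> carrier G" using assms by auto
  have "mset_prod G (y + z) = finprod G (\<lambda>u. u [^] count (y + z) u) ?A"
    using A by (subst mset_prod_eq_finprod[of ?A]) auto
  also have "\<dots> = finprod G (\<lambda>u. u [^] count y u \<otimes> u [^] count z u) ?A"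
    using A by (intro finprod_cong') (auto simp: nat_pow_mult subset_iff)
  also have "\<dots> = mset_prod G y \<otimes> mset_prod G z"
    using A by (subst finprod_multf)
      (auto simp: mset_prod_eq_finprod[of ?A] subset_iff)
  finally show ?thesis .
qed

lemma (in comm_monoid) mset_prod_single [simp]: "x \<in> carrier G \<Longrightarrow> mset_prod G {#x#} = x"
  by (simp add: mset_prod_def)

lemma (in comm_monoid) mset_prod_add_mset:
  "x \<in> carrier G \<Longrightarrow> set_mset z \<subseteq> carrier G \<Longrightarrow> mset_prod G (add_mset x z) = x \<otimes> mset_prod G z"
  using mset_prod_union[of "{#x#}" z] by simp

lemma free_monoid_simps [simp]:
  "carrier (free_monoid P) = {z. set_mset z \<subseteq> P}"
  "y \<otimes>\<^bsub>free_monoid P\<^esub> z = y + z"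
  "\<one>\<^bsub>free_monoid P\<^esub> = {#}"
  by (simp_all add: free_monoid_def)

lemma free_monoid_cancel: "comm_monoid_cancel (free_monoid P)"
  by (intro comm_monoid_cancelI comm_monoidI) auto

lemma free_monoid_divides_iff:
  "set_mset b \<subseteq> P \<Longrightarrow> a divides\<^bsub>free_monoid P\<^esub> b \<longleftrightarrow> a \<subseteq># b"
  by (auto simp: factor_def mset_subset_eq_exists_conv)

lemma (in comm_monoid_cancel) units_mult_iff:
  "a \<in> carrier G \<Longrightarrow> b \<in> carrier G \<Longrightarrow> a \<otimes> b \<in> Units G \<longleftrightarrow> a \<in> Units G \<and> b \<in> Units G"
  using unit_factor[of a b] unit_factor[of b a] by (auto simp: m_comm)

section \<open>Products of a given number of atoms\<close>

text \<open>Factorization lengths without passing to the reduced monoid: \<open>n\<close> is a length of \<open>a\<close> iff \<open>a\<close> is a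
  unit times a product of \<open>n\<close> atoms.\<close>

primrec atom_prods :: "('a, 'm) monoid_scheme \<Rightarrow> nat \<Rightarrow> 'a set" where
  "atom_prods G 0 = Units G"
| "atom_prods G (Suc n) = atoms G <#>\<^bsub>G\<^esub> atom_prods G n"

lemma mem_atom_prods_Suc:
  "x \<in> atom_prods G (Suc n) \<longleftrightarrow> (\<exists>u\<in>atoms G. \<exists>y\<in>atom_prods G n. x = u \<otimes>\<^bsub>G\<^esub> y)"
  by (auto simp: set_mult_def)

lemma atoms_closed: "u \<in> atoms G \<Longrightarrow> u \<in> carrier G"
  by (simp add: atoms_def)

lemma (in monoid) atom_prods_closed: "x \<in> atom_prods G n \<Longrightarrow> x \<in> carrier G"
  by (induction n arbitrary: x) (auto simp: mem_atom_prods_Suc atoms_closed simp del: atom_prods.simps(2))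

lemma mem_l_coset: "x \<in> a <#\<^bsub>G\<^esub> A \<longleftrightarrow> (\<exists>u\<in>A. x = a \<otimes>\<^bsub>G\<^esub> u)"
  by (auto simp: l_coset_def)

lemma (in comm_monoid_cancel) mem_own_coset: "a \<in> carrier G \<Longrightarrow> a \<in> a <# Units G"
  unfolding mem_l_coset by (rule bexI[of _ \<one>]) simp_all

lemma (in comm_monoid_cancel) unit_coset_eq_iff:
  assumes "a \<in> carrier G" "b \<in> carrier G"
  shows "a <# Units G = b <# Units G \<longleftrightarrow> (\<exists>u\<in>Units G. b = a \<otimes> u)"
proof
  assume "a <# Units G = b <# Units G"
  then have "b \<in> a <# Units G" using mem_own_coset[OF assms(2)] by simp
  then show "\<exists>u\<in>Units G. b = a \<otimes> u" by (simp add: mem_l_coset)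
next
  assume "\<exists>u\<in>Units G. b = a \<otimes> u"
  then obtain u where u: "u \<in> Units G" "b = a \<otimes> u" by blast
  have "a \<otimes> v \<in> b <# Units G" if "v \<in> Units G" for v
  proof -
    have "b \<otimes> (inv u \<otimes> v) = a \<otimes> ((u \<otimes> inv u) \<otimes> v)"
      using that u assms by (simp add: m_assoc Units_closed del: Units_r_inv)
    also have "\<dots> = a \<otimes> v" using that u by (simp add: Units_closed)
    finally show ?thesis using that u unfolding mem_l_coset by (metis Units_inv_Units Units_m_closed)
  qed
  moreover have "b \<otimes> v \<in> a <# Units G" if "v \<in> Units G" for v
    unfolding mem_l_coset using that u assms by (intro bexI[of _ "u \<otimes> v"]) (simp_all add: m_assoc Units_closed)
  ultimately show "a <# Units G = b <# Units G"
    by (auto simp: mem_l_coset)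
qed

lemma (in comm_monoid_cancel) set_mult_unit_cosets:
  assumes "a \<in> carrier G" "b \<in> carrier G"
  shows "(a <# Units G) <#> (b <# Units G) = (a \<otimes> b) <# Units G"
proof (intro equalityI subsetI)
  fix x assume "x \<in> (a <# Units G) <#> (b <# Units G)"
  then obtain u v where uv: "u \<in> Units G" "v \<in> Units G" "x = (a \<otimes> u) \<otimes> (b \<otimes> v)"
    by (auto simp: set_mult_def mem_l_coset)
  then have "x = (a \<otimes> b) \<otimes> (u \<otimes> v)"
    using assms by (simp add: m_ac Units_closed)
  with uv show "x \<in> (a \<otimes> b) <# Units G"
    unfolding mem_l_coset using Units_m_closed by blast
next
  fix x assume "x \<in> (a \<otimes> b) <# Units G"
  then obtain u where u: "u \<in> Units G" "x = (a \<otimes> b) \<otimes> u"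
    by (auto simp: mem_l_coset)
  then have "x = a \<otimes> (b \<otimes> u)"
    using assms by (simp add: m_assoc Units_closed)
  moreover have "b \<otimes> u \<in> b <# Units G" using u by (auto simp: mem_l_coset)
  ultimately show "x \<in> (a <# Units G) <#> (b <# Units G)"
    using mem_own_coset[OF assms(1)] by (auto simp: set_mult_def)
qed

lemma red_monoid_simps [simp]:
  "carrier (red_monoid G) = (\<lambda>a. a <#\<^bsub>G\<^esub> Units G) ` carrier G"
  "A \<otimes>\<^bsub>red_monoid G\<^esub> B = A <#>\<^bsub>G\<^esub> B"
  "\<one>\<^bsub>red_monoid G\<^esub> = Units G"
  by (simp_all add: red_monoid_def)

lemma (in comm_monoid_cancel) one_coset: "\<one> <# Units G = Units G"
  by (auto simp: l_coset_def Units_closed)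

lemma (in comm_monoid_cancel) coset_eq_Units_iff:
  "a \<in> carrier G \<Longrightarrow> a <# Units G = Units G \<longleftrightarrow> a \<in> Units G"
  using unit_coset_eq_iff[of \<one> a] by (auto simp: one_coset Units_closed)

lemma (in comm_monoid_cancel) Units_coset: "u \<in> Units G \<Longrightarrow> u <# Units G = Units G"
  by (simp add: coset_eq_Units_iff Units_closed)

lemma (in comm_monoid_cancel) red_monoid_cancel: "comm_monoid_cancel (red_monoid G)"
proof -
  have one: "Units G \<in> (\<lambda>a. a <# Units G) ` carrier G"
    using one_coset by (metis one_closed image_eqI)
  interpret R: comm_monoid "red_monoid G"
  proof (rule comm_monoidI, goal_cases)
    case (4 A)
    then obtain a where a: "a \<in> carrier G" "A = a <# Units G" by auto
    then show ?case
      using set_mult_unit_cosets[of \<one> a] one_coset by simp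
  qed (auto simp: one set_mult_unit_cosets m_ac)
  show ?thesis
  proof (rule comm_monoid_cancelI)
    fix A B D
    assume "A \<in> carrier (red_monoid G)" "B \<in> carrier (red_monoid G)" "D \<in> carrier (red_monoid G)"
    then obtain a b d where [simp]: "A = a <# Units G" "B = b <# Units G" "D = d <# Units G"
      and c: "a \<in> carrier G" "b \<in> carrier G" "d \<in> carrier G" by auto
    assume "A \<otimes>\<^bsub>red_monoid G\<^esub> D = B \<otimes>\<^bsub>red_monoid G\<^esub> D"
    then obtain u where u: "u \<in> Units G" "b \<otimes> d = (a \<otimes> d) \<otimes> u"
      using c by (auto simp: set_mult_unit_cosets unit_coset_eq_iff)
    then have "b \<otimes> d = (a \<otimes> u) \<otimes> d" using c u(1) by (simp add: m_ac Units_closed)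
    then have "b = a \<otimes> u" using c u(1) r_cancel[of b d "a \<otimes> u"] by (simp add: Units_closed)
    then show "A = B" using c u by (auto simp: unit_coset_eq_iff)
  qed (rule R.comm_monoid_axioms)
qed

lemma (in comm_monoid_cancel) reduced_red_monoid: "Units (red_monoid G) = {Units G}"
proof -
  have "A = Units G" if "A \<in> Units (red_monoid G)" for A
  proof -
    from that obtain a b where ab: "a \<in> carrier G" "b \<in> carrier G" "A = a <# Units G"
      "(a \<otimes> b) <# Units G = Units G"
      by (auto simp: Units_def[of "red_monoid G"] set_mult_unit_cosets)
    then have "a \<in> Units G"
      using coset_eq_Units_iff[of "a \<otimes> b"] by (simp add: units_mult_iff)
    with ab show ?thesis by (simp add: Units_coset)
  qed
  moreover have "Units G \<in> Units (red_monoid G)"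
    using comm_monoid_cancel.axioms(2)[OF red_monoid_cancel]
      monoid.Units_one_closed[of "red_monoid G"] by (simp add: comm_monoid_def)
  ultimately show ?thesis by blast
qed

text \<open>A factorization of the coset lifts to one of \<open>a\<close> itself: the unit by which
  \<open>b \<otimes> c\<close> differs from \<open>a\<close> is absorbed into the second factor,
  which remains a unit or a nonunit as before.\<close>

lemma (in comm_monoid_cancel) coset_in_atoms_iff:
  assumes "a \<in> carrier G"
  shows "a <# Units G \<in> atoms (red_monoid G) \<longleftrightarrow> a \<in> atoms G"
proof -
  interpret R: comm_monoid_cancel "red_monoid G" by (rule red_monoid_cancel)
  have "a <# Units G \<in> atoms (red_monoid G) \<longleftrightarrow> a \<notin> Units G \<and>
     (\<forall>b\<in>carrier G. \<forall>c\<in>carrier G. a <# Units G = (b \<otimes> c) <# Units G \<longrightarrow> b \<in> Units G \<or> c \<in> Units G)"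
    using assms unfolding R.atoms_alt_def reduced_red_monoid
    by (simp add: set_mult_unit_cosets coset_eq_Units_iff)
  also have "\<dots> \<longleftrightarrow> a \<in> atoms G"
  proof -
    have "b \<in> Units G \<or> c \<in> Units G"
      if *: "\<forall>b\<in>carrier G. \<forall>c\<in>carrier G. a = b \<otimes> c \<longrightarrow> b \<in> Units G \<or> c \<in> Units G"
        and bc: "b \<in> carrier G" "c \<in> carrier G" "a <# Units G = (b \<otimes> c) <# Units G" for b c
    proof -
      obtain u where u: "u \<in> Units G" "a = (b \<otimes> c) \<otimes> u"
        using bc assms unit_coset_eq_iff[of "b \<otimes> c" a] by auto
      then have "a = b \<otimes> (c \<otimes> u)" using bc by (simp add: m_assoc Units_closed)
      then have "b \<in> Units G \<or> c \<otimes> u \<in> Units G"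
        using * bc u by (simp add: Units_closed)
      then show ?thesis using bc u by (simp add: units_mult_iff Units_closed)
    qed
    then show ?thesis
      using assms unfolding atoms_alt_def mem_Collect_eq by blast
  qed
  finally show ?thesis .
qed

text \<open>One induction step removes one atom from the multiset. Representatives of the cosets
  multiply to \<open>a\<close> only up to a unit; this unit is handed on to the remaining product,
  which is why the induction runs over all \<open>a\<close>.\<close>

lemma (in comm_monoid_cancel) coset_eq_mset_prod_iff:
  assumes "a \<in> carrier G"
  shows "(\<exists>z. set_mset z \<subseteq> atoms (red_monoid G) \<and> size z = n \<and> mset_prod (red_monoid G) z = a <# Units G)
    \<longleftrightarrow> a \<in> atom_prods G n"
  using assms
proof (induction n arbitrary: a)
  case 0
  interpret R: comm_monoid_cancel "red_monoid G" by (rule red_monoid_cancel)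
  have "(\<exists>z. set_mset z \<subseteq> atoms (red_monoid G) \<and> size z = 0 \<and> mset_prod (red_monoid G) z = a <# Units G)
      \<longleftrightarrow> mset_prod (red_monoid G) {#} = a <# Units G"
    by fastforce
  then show ?case
    using coset_eq_Units_iff[OF 0] by (simp add: eq_commute[of "Units G"])
next
  case (Suc n)
  interpret R: comm_monoid_cancel "red_monoid G" by (rule red_monoid_cancel)
  let ?R = "red_monoid G"
  have sub: "set_mset z \<subseteq> carrier ?R" if "set_mset z \<subseteq> atoms ?R" for z
    using that atoms_closed[of _ ?R] by (meson subset_iff)
  show ?case
  proof
    assume "\<exists>z. set_mset z \<subseteq> atoms ?R \<and> size z = Suc n \<and> mset_prod ?R z = a <# Units G"
    then obtain z where z: "set_mset z \<subseteq> atoms ?R" "size z = Suc n" "mset_prod ?R z = a <# Units G"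
      by blast
    then obtain A w where w: "z = add_mset A w" by (meson size_eq_Suc_imp_eq_union)
    have A: "A \<in> carrier ?R" using sub[OF z(1)] w by auto
    then obtain u where u: "u \<in> carrier G" "A = u <# Units G" by auto
    have "mset_prod ?R w \<in> carrier ?R" using sub[OF z(1)] w by (intro R.mset_prod_closed) auto
    then obtain y where y: "y \<in> carrier G" "mset_prod ?R w = y <# Units G" by auto
    have "a <# Units G = (u \<otimes> y) <# Units G"
      using z w u y A sub[OF z(1)] by (simp add: R.mset_prod_add_mset set_mult_unit_cosets)
    then obtain v where v: "v \<in> Units G" "a = u \<otimes> y \<otimes> v"
      using unit_coset_eq_iff[of "u \<otimes> y" a] u y Suc.prems by auto
    have "mset_prod ?R w = (y \<otimes> v) <# Units G"
      using y v unit_coset_eq_iff[of y "y \<otimes> v"] by (simp add: Units_closed) blast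
    then have "y \<otimes> v \<in> atom_prods G n"
      using z w y v by (subst Suc.IH[symmetric]) auto
    moreover have "a = u \<otimes> (y \<otimes> v)" using u v y by (simp add: m_assoc Units_closed)
    moreover have "u \<in> atoms G" using u z w by (simp add: coset_in_atoms_iff)
    ultimately show "a \<in> atom_prods G (Suc n)" unfolding mem_atom_prods_Suc by blast
  next
    assume "a \<in> atom_prods G (Suc n)"
    then obtain u y where uy: "u \<in> atoms G" "y \<in> atom_prods G n" "a = u \<otimes> y"
      unfolding mem_atom_prods_Suc by blast
    then have c: "u \<in> carrier G" "y \<in> carrier G" by (auto simp: atoms_closed atom_prods_closed)
    obtain z where z: "set_mset z \<subseteq> atoms ?R" "size z = n" "mset_prod ?R z = y <# Units G"
      using Suc.IH[OF c(2)] uy by blast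
    have "mset_prod ?R (add_mset (u <# Units G) z) = a <# Units G"
      using z sub[OF z(1)] c uy by (subst R.mset_prod_add_mset) (auto simp: set_mult_unit_cosets)
    then show "\<exists>z. set_mset z \<subseteq> atoms ?R \<and> size z = Suc n \<and> mset_prod ?R z = a <# Units G"
      using z uy c by (intro exI[of _ "add_mset (u <# Units G) z"]) (auto simp: coset_in_atoms_iff)
  qed
qed

lemma (in comm_monoid_cancel) length_set_eq:
  assumes "a \<in> carrier G"
  shows "length_set G a = {n. a \<in> atom_prods G n}"
  unfolding coset_eq_mset_prod_iff[OF assms, symmetric]
  by (auto simp: length_set_def factorizations_def)

section \<open>Transport of units, atoms and lengths along isomorphisms\<close>

lemma iso_Units:
  assumes "comm_monoid G" "comm_monoid K" "h \<in> iso G K"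
  shows "Units K = h ` Units G"
proof -
  interpret G: comm_monoid G by fact
  interpret K: comm_monoid K by fact
  have hom: "h \<in> hom G K" and bij: "bij_betw h (carrier G) (carrier K)"
    using assms(3) by (auto simp: iso_def)
  have closed: "h a \<in> carrier K" if "a \<in> carrier G" for a
    using bij that by (auto simp: bij_betw_def)
  have surj: "\<exists>a\<in>carrier G. x = h a" if "x \<in> carrier K" for x
    using bij that by (auto simp: bij_betw_def)
  have inj: "h a = h b \<longleftrightarrow> a = b" if "a \<in> carrier G" "b \<in> carrier G" for a b
    using bij that by (auto simp: bij_betw_def inj_on_def)
  \<comment> \<open>\<open>hom\<close> does not demand that the identity is preserved. Here
    surjectivity forces it, through a preimage \<open>a\<close> of the identity of
    \<open>K\<close>.\<close>
  have one: "h \<one>\<^bsub>G\<^esub> = \<one>\<^bsub>K\<^esub>"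
  proof -
    obtain a where a: "a \<in> carrier G" "\<one>\<^bsub>K\<^esub> = h a" using surj by blast
    have "h \<one>\<^bsub>G\<^esub> = h \<one>\<^bsub>G\<^esub> \<otimes>\<^bsub>K\<^esub> h a"
      using a closed[of "\<one>\<^bsub>G\<^esub>"] K.r_one by simp
    also have "\<dots> = h a" using a by (simp flip: hom_mult[OF hom])
    finally show ?thesis using a by simp
  qed
  have inv_iff: "h a \<otimes>\<^bsub>K\<^esub> h b = \<one>\<^bsub>K\<^esub> \<longleftrightarrow> a \<otimes>\<^bsub>G\<^esub> b = \<one>\<^bsub>G\<^esub>" if "a \<in> carrier G" "b \<in> carrier G" for a b
    using that by (metis one G.m_closed G.one_closed hom_mult[OF hom] inj)
  have "\<exists>a\<in>Units G. x = h a" if "x \<in> Units K" for x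
  proof -
    from that obtain y where "x \<in> carrier K" "y \<in> carrier K" "x \<otimes>\<^bsub>K\<^esub> y = \<one>\<^bsub>K\<^esub>"
      by (auto simp: Units_def K.m_comm)
    moreover from this obtain a b where "a \<in> carrier G" "b \<in> carrier G" "x = h a" "y = h b"
      using surj by metis
    ultimately show ?thesis
      using inv_iff[of a b] unfolding Units_def by (auto simp: G.m_comm intro!: bexI[of _ b] exI[of _ a])
  qed
  moreover have "h a \<in> Units K" if "a \<in> Units G" for a
    using that closed inv_iff by (fastforce simp: Units_def)
  ultimately show ?thesis by blast
qed

lemma iso_atoms:
  assumes "comm_monoid_cancel G" "comm_monoid_cancel K" "h \<in> iso G K"
  shows "atoms K = h ` atoms G"
proof -
  interpret G: comm_monoid_cancel G by fact
  interpret K: comm_monoid_cancel K by fact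
  have hom: "h \<in> hom G K" and bij: "bij_betw h (carrier G) (carrier K)"
    using assms(3) by (auto simp: iso_def)
  have img: "carrier K = h ` carrier G" using bij by (simp add: bij_betw_def)
  have inj: "h a = h b \<longleftrightarrow> a = b" if "a \<in> carrier G" "b \<in> carrier G" for a b
    using bij that by (auto simp: bij_betw_def inj_on_def)
  have units: "h a \<in> Units K \<longleftrightarrow> a \<in> Units G" if "a \<in> carrier G" for a
    unfolding iso_Units[OF G.comm_monoid_axioms K.comm_monoid_axioms assms(3)]
    using that inj G.Units_closed by blast
  have "h a \<in> atoms K \<longleftrightarrow> a \<in> atoms G" if a: "a \<in> carrier G" for a
    unfolding G.atoms_alt_def K.atoms_alt_def unfolding img
    using a units inj by (auto simp: hom_mult[OF hom, symmetric])
  then show ?thesis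
    using atoms_closed[of _ G] atoms_closed[of _ K] unfolding img by blast
qed

lemma iso_atom_prods:
  assumes "comm_monoid_cancel G" "comm_monoid_cancel K" "h \<in> iso G K"
  shows "atom_prods K n = h ` atom_prods G n"
proof (induction n)
  case 0
  then show ?case using iso_Units[OF _ _ assms(3)] assms(1,2)
    by (simp add: comm_monoid_cancel.axioms(2))
next
  case (Suc n)
  interpret G: comm_monoid_cancel G by fact
  have hom: "h \<in> hom G K" using assms(3) by (auto simp: iso_def)
  have "h ` (A <#>\<^bsub>G\<^esub> B) = h ` A <#>\<^bsub>K\<^esub> h ` B" if "A \<subseteq> carrier G" "B \<subseteq> carrier G" for A B
  proof -
    have "h (a \<otimes>\<^bsub>G\<^esub> b) = h a \<otimes>\<^bsub>K\<^esub> h b" if "a \<in> A" "b \<in> B" for a b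
      using that \<open>A \<subseteq> _\<close> \<open>B \<subseteq> _\<close> by (intro hom_mult[OF hom]) auto
    then have "h ` (A <#>\<^bsub>G\<^esub> B) = (\<Union>a\<in>A. \<Union>b\<in>B. {h a \<otimes>\<^bsub>K\<^esub> h b})"
      unfolding set_mult_def by (simp add: image_UN)
    then show ?thesis unfolding set_mult_def by simp
  qed
  from this[of "atoms G" "atom_prods G n"] show ?case
    using Suc iso_atoms[OF assms] by (auto simp: atoms_closed G.atom_prods_closed subset_iff)
qed

section \<open>Lengths in direct products, groups and free monoids\<close>

lemma DirProd_cancel:
  assumes "comm_monoid_cancel G" "comm_monoid_cancel K"
  shows "comm_monoid_cancel (G \<times>\<times> K)"
proof -
  interpret G: comm_monoid_cancel G by fact
  interpret K: comm_monoid_cancel K by fact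
  show ?thesis
    by (intro comm_monoid_cancelI comm_monoidI)
      (auto simp: G.m_ac K.m_ac intro: G.r_cancel K.r_cancel)
qed

lemma Units_DirProd:
  assumes "comm_monoid_cancel G" "comm_monoid_cancel K"
  shows "Units (G \<times>\<times> K) = Units G \<times> Units K"
proof -
  interpret G: comm_monoid_cancel G by fact
  interpret K: comm_monoid_cancel K by fact
  have "(a, b) \<in> Units (G \<times>\<times> K) \<longleftrightarrow> a \<in> Units G \<and> b \<in> Units K" for a b
    unfolding Units_def by (auto simp: Bex_def; blast)
  then show ?thesis by auto
qed

text \<open>As \<open>(a, b)\<close> is the product of \<open>(a, \<one>)\<close> and
  \<open>(\<one>, b)\<close>, an atom has a unit in one coordinate, and the other coordinate
  inherits irreducibility.\<close>

lemma DirProd_atoms_iff: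
  assumes "comm_monoid_cancel G" "comm_monoid_cancel K"
  shows "(a, b) \<in> atoms (G \<times>\<times> K) \<longleftrightarrow> a \<in> atoms G \<and> b \<in> Units K \<or> a \<in> Units G \<and> b \<in> atoms K"
proof -
  interpret G: comm_monoid_cancel G by fact
  interpret K: comm_monoid_cancel K by fact
  interpret D: comm_monoid_cancel "G \<times>\<times> K" by (rule DirProd_cancel) fact+
  show ?thesis
  proof (cases "a \<in> carrier G \<and> b \<in> carrier K")
    case False
    then show ?thesis by (auto simp: atoms_def Units_def)
  next
    case True
    then have c: "a \<in> carrier G" "b \<in> carrier K" by auto
    show ?thesis
    proof
      assume "(a, b) \<in> atoms (G \<times>\<times> K)"
      then have nu: "\<not> (a \<in> Units G \<and> b \<in> Units K)"
        and irr: "\<And>a1 b1 a2 b2. \<lbrakk>a1 \<in> carrier G; a2 \<in> carrier G; b1 \<in> carrier K; b2 \<in> carrier K;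
             a = a1 \<otimes>\<^bsub>G\<^esub> a2; b = b1 \<otimes>\<^bsub>K\<^esub> b2\<rbrakk>
           \<Longrightarrow> (a1 \<in> Units G \<and> b1 \<in> Units K) \<or> (a2 \<in> Units G \<and> b2 \<in> Units K)"
        unfolding D.atoms_alt_def by (simp_all add: Units_DirProd[OF assms])
      have u: "a \<in> Units G \<or> b \<in> Units K"
        using irr[of a "\<one>\<^bsub>G\<^esub>" "\<one>\<^bsub>K\<^esub>" b] c by auto
      have A: "a1 \<in> Units G \<or> a2 \<in> Units G"
        if "a1 \<in> carrier G" "a2 \<in> carrier G" "a = a1 \<otimes>\<^bsub>G\<^esub> a2" for a1 a2
        using irr[of a1 a2 b "\<one>\<^bsub>K\<^esub>"] c that by auto
      have B: "b1 \<in> Units K \<or> b2 \<in> Units K"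
        if "b1 \<in> carrier K" "b2 \<in> carrier K" "b = b1 \<otimes>\<^bsub>K\<^esub> b2" for b1 b2
        using irr[of a "\<one>\<^bsub>G\<^esub>" b1 b2] c that by auto
      show "a \<in> atoms G \<and> b \<in> Units K \<or> a \<in> Units G \<and> b \<in> atoms K"
        using u nu A B c by (auto simp: G.atoms_alt_def K.atoms_alt_def)
    next
      assume "a \<in> atoms G \<and> b \<in> Units K \<or> a \<in> Units G \<and> b \<in> atoms K"
      then show "(a, b) \<in> atoms (G \<times>\<times> K)"
        unfolding D.atoms_alt_def
        using c by (auto simp: G.atoms_alt_def K.atoms_alt_def Units_DirProd[OF assms] G.units_mult_iff K.units_mult_iff)
    qed
  qed
qed

text \<open>\<open>a\<close> and \<open>u \<otimes> a\<close> have the same coset, and being an atom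
  can be read off the coset.\<close>

lemma (in comm_monoid_cancel) unit_mult_atom:
  "u \<in> Units G \<Longrightarrow> a \<in> atoms G \<Longrightarrow> u \<otimes> a \<in> atoms G"
  unfolding coset_in_atoms_iff[symmetric, OF m_closed, OF Units_closed atoms_closed]
  using coset_in_atoms_iff[of a] unit_coset_eq_iff[of a "u \<otimes> a"]
  by (metis Units_closed atoms_closed coset_in_atoms_iff m_closed m_comm)

text \<open>An atom of a direct product carries a unit in its other coordinate; this lemma lets that
  unit disappear into the product formed there.\<close>

lemma (in comm_monoid_cancel) unit_mult_atom_prods:
  assumes "u \<in> Units G" "a \<in> atom_prods G n"
  shows "u \<otimes> a \<in> atom_prods G n"
proof (cases n)
  case (Suc m)
  then obtain b c where "b \<in> atoms G" "c \<in> atom_prods G m" "a = b \<otimes> c"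
    using assms by (auto simp: mem_atom_prods_Suc simp del: atom_prods.simps)
  moreover from this have "u \<otimes> a = (u \<otimes> b) \<otimes> c"
    using assms by (simp add: m_assoc atoms_closed atom_prods_closed Units_closed)
  ultimately show ?thesis
    using assms Suc unit_mult_atom by (auto simp: mem_atom_prods_Suc simp del: atom_prods.simps)
qed (use assms in auto)

text \<open>Each atom of the direct product is an atom in exactly one coordinate and adds 1 to the
  length there, so the lengths of the two coordinates add up.\<close>

lemma DirProd_atom_prods_iff:
  assumes "comm_monoid_cancel G" "comm_monoid_cancel K"
  shows "(a, b) \<in> atom_prods (G \<times>\<times> K) n \<longleftrightarrow>
    (\<exists>i j. n = i + j \<and> a \<in> atom_prods G i \<and> b \<in> atom_prods K j)"
proof (induction n arbitrary: a b)
  case 0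
  then show ?case by (simp add: Units_DirProd[OF assms])
next
  case (Suc n)
  interpret G: comm_monoid_cancel G by fact
  interpret K: comm_monoid_cancel K by fact
  show ?case
  proof
    assume "(a, b) \<in> atom_prods (G \<times>\<times> K) (Suc n)"
    then obtain u v c d i j where *: "(u, v) \<in> atoms (G \<times>\<times> K)" "n = i + j" "c \<in> atom_prods G i"
      "d \<in> atom_prods K j" "a = u \<otimes>\<^bsub>G\<^esub> c" "b = v \<otimes>\<^bsub>K\<^esub> d"
      using Suc.IH by (fastforce simp: mem_atom_prods_Suc simp del: atom_prods.simps)
    from *(1) consider "u \<in> atoms G" "v \<in> Units K" | "u \<in> Units G" "v \<in> atoms K"
      using DirProd_atoms_iff[OF assms] by auto
    then show "\<exists>i j. Suc n = i + j \<and> a \<in> atom_prods G i \<and> b \<in> atom_prods K j"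
    proof cases
      case 1
      with * have "a \<in> atom_prods G (Suc i)" "b \<in> atom_prods K j"
        using K.unit_mult_atom_prods by (auto simp: mem_atom_prods_Suc simp del: atom_prods.simps)
      with * show ?thesis by (metis add_Suc)
    next
      case 2
      with * have "a \<in> atom_prods G i" "b \<in> atom_prods K (Suc j)"
        using G.unit_mult_atom_prods by (auto simp: mem_atom_prods_Suc simp del: atom_prods.simps)
      with * show ?thesis by (metis add_Suc_right)
    qed
  next
    assume "\<exists>i j. Suc n = i + j \<and> a \<in> atom_prods G i \<and> b \<in> atom_prods K j"
    then obtain i j where ij: "Suc n = i + j" "a \<in> atom_prods G i" "b \<in> atom_prods K j" by blast
    show "(a, b) \<in> atom_prods (G \<times>\<times> K) (Suc n)"
    proof (cases i)
      case 0
      then obtain m where m: "j = Suc m" "n = m" using ij by auto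
      then obtain v d where vd: "v \<in> atoms K" "d \<in> atom_prods K m" "b = v \<otimes>\<^bsub>K\<^esub> d"
        using ij by (auto simp: mem_atom_prods_Suc simp del: atom_prods.simps)
      have "(\<one>\<^bsub>G\<^esub>, v) \<in> atoms (G \<times>\<times> K)" using vd DirProd_atoms_iff[OF assms] by auto
      moreover have "(a, d) \<in> atom_prods (G \<times>\<times> K) n"
        unfolding Suc.IH using vd ij 0 m by (intro exI[of _ 0] exI[of _ m]) auto
      moreover have "(a, b) = (\<one>\<^bsub>G\<^esub>, v) \<otimes>\<^bsub>G \<times>\<times> K\<^esub> (a, d)"
        using vd ij G.atom_prods_closed by auto
      ultimately show ?thesis unfolding mem_atom_prods_Suc by blast
    next
      case (Suc m)
      then obtain u c where uc: "u \<in> atoms G" "c \<in> atom_prods G m" "a = u \<otimes>\<^bsub>G\<^esub> c"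
        using ij by (auto simp: mem_atom_prods_Suc simp del: atom_prods.simps)
      have "(u, \<one>\<^bsub>K\<^esub>) \<in> atoms (G \<times>\<times> K)" using uc DirProd_atoms_iff[OF assms] by auto
      moreover have "(c, b) \<in> atom_prods (G \<times>\<times> K) n"
        unfolding Suc.IH using uc ij Suc by (intro exI[of _ m] exI[of _ j]) auto
      moreover have "(a, b) = (u, \<one>\<^bsub>K\<^esub>) \<otimes>\<^bsub>G \<times>\<times> K\<^esub> (c, b)"
        using uc ij K.atom_prods_closed by auto
      ultimately show ?thesis unfolding mem_atom_prods_Suc by blast
    qed
  qed
qed

text \<open>Meant for the factor \<open>units_of H\<close>: a group has no atoms, so 0 is its only
  length.\<close>

lemma atom_prods_group:
  assumes "Units G = carrier G"
  shows "atom_prods G n = (if n = 0 then carrier G else {})"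
proof -
  have "atoms G = {}" using assms by (auto simp: atoms_def irreducible_def)
  then show ?thesis using assms by (cases n) (auto simp: set_mult_def)
qed

lemma Units_free_monoid: "Units (free_monoid P) = {{#}}"
  by (auto simp: Units_def)

lemma atoms_free_monoid: "atoms (free_monoid P) = (\<lambda>p. {#p#}) ` P"
proof -
  interpret comm_monoid_cancel "free_monoid P" by (rule free_monoid_cancel)
  have "\<exists>p\<in>P. z = {#p#}" if z: "set_mset z \<subseteq> P" "z \<noteq> {#}"
    "\<And>a b. \<lbrakk>set_mset a \<subseteq> P; set_mset b \<subseteq> P; z = a + b\<rbrakk> \<Longrightarrow> a = {#} \<or> b = {#}" for z
  proof -
    from z(2) obtain p y where "z = add_mset p y" by (meson multiset_cases)
    with z(1) z(3)[of "{#p#}" y] show ?thesis by auto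
  qed
  then show ?thesis
    unfolding atoms_alt_def Units_free_monoid
    by (auto simp: image_iff single_is_union)
qed

lemma mem_atom_prods_free_monoid:
  "z \<in> atom_prods (free_monoid P) n \<longleftrightarrow> set_mset z \<subseteq> P \<and> size z = n"
proof (induction n arbitrary: z)
  case 0
  then show ?case by (auto simp: Units_free_monoid)
next
  case (Suc n)
  have "z \<in> atom_prods (free_monoid P) (Suc n) \<longleftrightarrow> (\<exists>p\<in>P. \<exists>y. set_mset y \<subseteq> P \<and> size y = n \<and> z = add_mset p y)"
    using Suc by (auto simp: mem_atom_prods_Suc atoms_free_monoid simp del: atom_prods.simps)
  also have "\<dots> \<longleftrightarrow> set_mset z \<subseteq> P \<and> size z = Suc n"
    using size_eq_Suc_imp_eq_union[of z n] by auto blast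
  finally show ?case .
qed

section \<open>Zero-sum sequences as matrices\<close>

text \<open>The exchange point between group theory and combinatorics: \<open>mem_Z_iff\<close> is
  all that remains of addition in the group. Its \<open>a\<close> and \<open>c\<close> are integers
  and may be negative. \<open>U\<close> and \<open>V\<close> are parameters with defining equations,
  so that the interpretation can use the terms of the theorem.\<close>

locale grid =
  fixes e :: "nat \<Rightarrow> nat \<Rightarrow> 'g" and s :: "nat \<Rightarrow> nat" and k t :: nat and G0 :: "'g set"
    and Z :: "'g multiset set" and U V :: "nat \<Rightarrow> 'g multiset"
  assumes k_pos: "k \<ge> 1" and s_pos: "j \<le> t \<Longrightarrow> s j \<ge> 1" and s_sum: "(\<Sum>j=0..t. s j) \<ge> 2"
    and e_inj: "\<lbrakk>i \<le> k; i' \<le> k; j \<le> t; j' \<le> t; e i j = e i' j'\<rbrakk> \<Longrightarrow> i = i' \<and> j = j'"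
    and G0_eq: "G0 = {e i j | i j. i \<le> k \<and> j \<le> t}"
    and mem_Z_iff: "B \<in> Z \<longleftrightarrow> set_mset B \<subseteq> G0 \<and>
      (\<exists>a c. \<forall>i\<le>k. \<forall>j\<le>t. int (count B (e i j)) = a j + c i * int (s j))"
    and U_def: "U i = (\<Sum>j=0..t. replicate_mset (s j) (e i j))"
    and V_def: "V j = (\<Sum>i=0..k. {#e i j#})"
begin

text \<open>Only the values of \<open>\<alpha>\<close> on \<open>{0..k}\<close> and of
  \<open>\<beta>\<close> on \<open>{0..t}\<close> matter (\<open>comb_cong\<close>), so uniqueness
  of exponents can hold on these ranges only.\<close>

definition comb :: "(nat \<Rightarrow> nat) \<Rightarrow> (nat \<Rightarrow> nat) \<Rightarrow> 'g multiset" where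
  "comb \<alpha> \<beta> = (\<Sum>i=0..k. repeat_mset (\<alpha> i) (U i)) + (\<Sum>j=0..t. repeat_mset (\<beta> j) (V j))"

lemma count_U: "i \<le> k \<Longrightarrow> p \<le> k \<Longrightarrow> q \<le> t \<Longrightarrow> count (U i) (e p q) = (if i = p then s q else 0)"
proof -
  assume *: "i \<le> k" "p \<le> k" "q \<le> t"
  have "count (U i) (e p q) = (\<Sum>j=0..t. if i = p \<and> j = q then s q else 0)"
    unfolding U_def count_sum using * by (intro sum.cong) (auto dest: e_inj)
  then show ?thesis using * by (cases "i = p") (auto simp: sum.delta)
qed

lemma count_V: "j \<le> t \<Longrightarrow> p \<le> k \<Longrightarrow> q \<le> t \<Longrightarrow> count (V j) (e p q) = (if j = q then 1 else 0)"
proof -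
  assume *: "j \<le> t" "p \<le> k" "q \<le> t"
  have "count (V j) (e p q) = (\<Sum>i=0..k. if i = p \<and> j = q then 1 else 0)"
    unfolding V_def count_sum using * by (intro sum.cong) (auto dest: e_inj)
  then show ?thesis using * by (cases "j = q") (auto simp: sum.delta)
qed

lemma count_comb: "p \<le> k \<Longrightarrow> q \<le> t \<Longrightarrow> count (comb \<alpha> \<beta>) (e p q) = \<alpha> p * s q + \<beta> q"
  by (simp add: comb_def count_sum count_U count_V if_distrib[of "(*) _"] cong: if_cong sum.cong_simp)

lemma set_comb: "set_mset (comb \<alpha> \<beta>) \<subseteq> G0"
proof -
  have "set_mset (U i) \<subseteq> G0" if "i \<le> k" for i
    using that by (auto simp: U_def G0_eq set_mset_sum split: if_splits) blast
  moreover have "set_mset (V j) \<subseteq> G0" if "j \<le> t" for j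
    using that by (auto simp: V_def G0_eq set_mset_sum) blast
  ultimately show ?thesis
    by (fastforce simp: comb_def set_mset_sum count_greater_zero_iff[symmetric] simp del: count_greater_zero_iff)
qed

lemma grid_multiset_eqI:
  assumes "set_mset A \<subseteq> G0" "set_mset B \<subseteq> G0"
    and "\<And>i j. i \<le> k \<Longrightarrow> j \<le> t \<Longrightarrow> count A (e i j) = count B (e i j)"
  shows "A = B"
proof (rule multiset_eqI)
  fix x show "count A x = count B x"
  proof (cases "x \<in> G0")
    case True then show ?thesis using assms(3) by (auto simp: G0_eq)
  next
    case False then show ?thesis using assms(1,2) by (metis not_in_iff subsetD)
  qed
qed

lemma comb_eq_iff:
  "comb \<alpha> \<beta> = B \<longleftrightarrow> set_mset B \<subseteq> G0 \<and> (\<forall>i\<le>k. \<forall>j\<le>t. count B (e i j) = \<alpha> i * s j + \<beta> j)"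
  using set_comb by (auto simp: count_comb intro!: grid_multiset_eqI)

lemma comb_in_Z: "comb \<alpha> \<beta> \<in> Z"
  unfolding mem_Z_iff
  by (intro conjI set_comb exI[of _ "\<lambda>j. int (\<beta> j)"] exI[of _ "\<lambda>i. int (\<alpha> i)"])
    (simp add: count_comb)

lemma Z_comb:
  assumes "B \<in> Z"
  shows "\<exists>\<alpha> \<beta>. B = comb \<alpha> \<beta> \<and> (\<exists>i\<le>k. \<alpha> i = 0)"
proof -
  obtain a c where B: "set_mset B \<subseteq> G0"
    and ac: "\<And>i j. i \<le> k \<Longrightarrow> j \<le> t \<Longrightarrow> int (count B (e i j)) = a j + c i * int (s j)"
    using assms unfolding mem_Z_iff by blast
  \<comment> \<open>Shifting all \<open>c i\<close> by the least of them keeps the matrix if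
    \<open>a\<close> is shifted accordingly. The shifted \<open>a\<close> is then the row
    \<open>p\<close> itself, and its entries are nonnegative for being multiplicities.\<close>
  define m where "m = Min (c ` {..k})"
  have m: "m \<le> c i" if "i \<le> k" for i using that unfolding m_def by auto
  have "m \<in> c ` {..k}" unfolding m_def by (rule Min_in) auto
  then obtain p where p: "p \<le> k" "c p = m" by auto
  have "B = comb (\<lambda>i. nat (c i - m)) (\<lambda>j. count B (e p j))"
    unfolding eq_commute[of B] comb_eq_iff
  proof (intro conjI allI impI B)
    fix i j assume ij: "i \<le> k" "j \<le> t"
    have "int (count B (e i j)) = int (nat (c i - m) * s j + count B (e p j))"
      using ac[OF ij] ac[OF p(1) ij(2)] m[OF ij(1)] p by (simp add: algebra_simps)
    then show "count B (e i j) = nat (c i - m) * s j + count B (e p j)"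
      by (simp only: of_nat_eq_iff)
  qed
  then show ?thesis using p by (intro exI[of _ "\<lambda>i. nat (c i - m)"] exI conjI) auto
qed

lemma Z_comb_ex: "B \<in> Z \<longleftrightarrow> (\<exists>\<alpha> \<beta>. B = comb \<alpha> \<beta>)"
  using Z_comb comb_in_Z by blast

lemma comb_cong:
  "(\<And>i. i \<le> k \<Longrightarrow> \<alpha> i = \<alpha>' i) \<Longrightarrow> (\<And>j. j \<le> t \<Longrightarrow> \<beta> j = \<beta>' j) \<Longrightarrow> comb \<alpha> \<beta> = comb \<alpha>' \<beta>'"
  by (simp add: comb_def cong: sum.cong_simp)

lemma comb_add: "comb \<alpha> \<beta> + comb \<alpha>' \<beta>' = comb (\<lambda>i. \<alpha> i + \<alpha>' i) (\<lambda>j. \<beta> j + \<beta>' j)"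
  using set_comb by (intro grid_multiset_eqI) (auto simp: count_comb algebra_simps)

text \<open>Comparing row \<open>i\<close> with row \<open>p\<close> shows that
  \<open>\<alpha> i - y i\<close> does not depend on \<open>i\<close>; as \<open>y p = 0\<close>,
  this common value \<open>\<nu>\<close> is \<open>\<alpha> p\<close> and hence nonnegative. The
  condition \<open>z q < s q\<close> yields \<open>\<nu> \<le> x\<close>. Thus \<open>p\<close>
  controls the lower and \<open>q\<close> the upper end of the range of \<open>\<nu>\<close>.
  Uniqueness, atoms and lengths all rest on this.\<close>

lemma comb_reduced_eq_iff:
  assumes "p \<le> k" "y p = 0" "q \<le> t" "z q < s q"
  shows "comb \<alpha> \<beta> = comb y (\<lambda>j. z j + x * s j) \<longleftrightarrow>
    (\<exists>\<nu>\<le>x. (\<forall>i\<le>k. \<alpha> i = y i + \<nu>) \<and> (\<forall>j\<le>t. \<beta> j = z j + (x - \<nu>) * s j))"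
    (is "?L \<longleftrightarrow> ?R")
proof
  assume L: ?L
  have eq: "\<alpha> i * s j + \<beta> j = y i * s j + (z j + x * s j)" if "i \<le> k" "j \<le> t" for i j
    using arg_cong[OF L, of "\<lambda>A. count A (e i j)"] that by (simp add: count_comb)
  have A: "\<alpha> i = y i + \<alpha> p" if "i \<le> k" for i
  proof -
    have "(\<alpha> i) * s 0 = (y i + \<alpha> p) * s 0"
      using eq[OF that, of 0] eq[OF assms(1), of 0] assms(2) by (simp add: algebra_simps)
    then show ?thesis using s_pos[of 0] by simp
  qed
  have p: "\<alpha> p * s j + \<beta> j = z j + x * s j" if "j \<le> t" for j
    using eq[OF assms(1) that] assms(2) by simp
  \<comment> \<open>In column \<open>q\<close> the remainder \<open>z q\<close> is too small to make
    room for another copy of \<open>s q\<close>.\<close>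
  have "\<alpha> p * s q < (x + 1) * s q"
    using p[OF assms(3)] assms(4) by simp
  then have le: "\<alpha> p \<le> x" by (metis mult_less_cancel2 less_Suc_eq_le Suc_eq_plus1)
  have "\<beta> j = z j + (x - \<alpha> p) * s j" if "j \<le> t" for j
  proof -
    from le obtain d where "x = \<alpha> p + d" using le_Suc_ex by blast
    then show ?thesis using p[OF that] by (simp add: algebra_simps)
  qed
  with A le show ?R by blast
next
  assume ?R
  then obtain \<nu> where \<nu>: "\<nu> \<le> x" "\<And>i. i \<le> k \<Longrightarrow> \<alpha> i = y i + \<nu>"
    "\<And>j. j \<le> t \<Longrightarrow> \<beta> j = z j + (x - \<nu>) * s j" by blast
  from \<nu>(1) obtain d where "x = \<nu> + d" using le_Suc_ex by blast
  then show ?L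
    unfolding comb_eq_iff using set_comb \<nu> by (auto simp: count_comb algebra_simps)
qed

text \<open>The case \<open>x = 0\<close>, in which \<open>\<nu>\<close> can only be 0. Each single
  \<open>U i\<close> and each single \<open>V j\<close> is a combination of this kind, which is how
  they are seen to be atoms.\<close>

lemma comb_unique:
  assumes "p \<le> k" "\<alpha>' p = 0" "q \<le> t" "\<beta>' q < s q"
  shows "comb \<alpha> \<beta> = comb \<alpha>' \<beta>' \<longleftrightarrow> (\<forall>i\<le>k. \<alpha> i = \<alpha>' i) \<and> (\<forall>j\<le>t. \<beta> j = \<beta>' j)"
  using comb_reduced_eq_iff[of p \<alpha>' q \<beta>' \<alpha> \<beta> 0] assms by auto

lemma U_eq_comb: "i \<le> k \<Longrightarrow> U i = comb (\<lambda>p. if p = i then 1 else 0) (\<lambda>_. 0)"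
  by (auto simp: comb_def if_distrib[of "\<lambda>x. repeat_mset x _"] cong: if_cong)

lemma V_eq_comb: "j \<le> t \<Longrightarrow> V j = comb (\<lambda>_. 0) (\<lambda>q. if q = j then 1 else 0)"
  by (auto simp: comb_def if_distrib[of "\<lambda>x. repeat_mset x _"] cong: if_cong)

lemma comb_zero: "comb (\<lambda>_. 0) (\<lambda>_. 0) = {#}"
  by (simp add: comb_def)

lemma ex_other_row: "\<exists>p\<le>k. p \<noteq> i"
  using k_pos by (cases "i = 0") auto

text \<open>Provides the column that \<open>comb_unique\<close> requires for \<open>V j\<close>.
  Without it \<open>s\<close> would sum to at most 1, which means \<open>t = 0\<close> and
  \<open>s 0 = 1\<close>; then \<open>V 0\<close> would be the product of all \<open>U i\<close> and
  no atom.\<close>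

lemma ex_gap_column: "\<exists>q\<le>t. (if q = j then 1 else 0) < s q"
proof (rule ccontr)
  assume "\<not> ?thesis"
  then have *: "s q \<le> (if q = j then 1 else 0)" if "q \<le> t" for q using that by force
  then have "(\<Sum>q=0..t. s q) \<le> (\<Sum>q=0..t. if q = j then 1 else 0)"
    by (intro sum_mono) simp
  then show False using s_sum by (simp split: if_splits)
qed

lemma U_sum_eq: "(\<Sum>i=0..k. U i) = (\<Sum>j=0..t. repeat_mset (s j) (V j))"
proof -
  have "comb (\<lambda>_. 1) (\<lambda>_. 0) = comb (\<lambda>_. 0) s"
    unfolding comb_eq_iff[of "\<lambda>_. 1"] using set_comb by (auto simp: count_comb)
  then show ?thesis by (simp add: comb_def)
qed

section \<open>The zero-sum monoid and its atoms\<close>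

definition M :: "'g multiset monoid" where
  "M = (free_monoid G0)\<lparr>carrier := Z\<rparr>"

lemma M_simps [simp]: "carrier M = Z" "x \<otimes>\<^bsub>M\<^esub> y = x + y" "\<one>\<^bsub>M\<^esub> = {#}"
  by (simp_all add: M_def free_monoid_def)

lemma Z_add: "A \<in> Z \<Longrightarrow> B \<in> Z \<Longrightarrow> A + B \<in> Z"
  by (metis Z_comb_ex comb_add)

lemma Z_empty: "{#} \<in> Z"
  by (metis comb_in_Z comb_zero)

lemma M_cancel: "comm_monoid_cancel M"
  by (intro comm_monoid_cancelI comm_monoidI) (auto simp: Z_add Z_empty)

lemma Units_M: "Units M = {{#}}"
  by (auto simp: Units_def Z_empty)

text \<open>Uniqueness makes the exponents of \<open>A\<close> and \<open>B\<close> add up to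
  \<open>\<alpha>'\<close> and \<open>\<beta>'\<close>. A total of 1 cannot be shared, so one side
  has only zero exponents.\<close>

lemma comb_split_trivial:
  assumes "comb \<alpha>' \<beta>' = A + B" "A \<in> Z" "B \<in> Z"
    and "p \<le> k" "\<alpha>' p = 0" "q \<le> t" "\<beta>' q < s q"
    and "(\<Sum>i=0..k. \<alpha>' i) + (\<Sum>j=0..t. \<beta>' j) = 1"
  shows "A = {#} \<or> B = {#}"
proof -
  obtain \<alpha>1 \<beta>1 \<alpha>2 \<beta>2 where A: "A = comb \<alpha>1 \<beta>1" and B: "B = comb \<alpha>2 \<beta>2"
    using assms by (metis Z_comb_ex)
  have "comb (\<lambda>i. \<alpha>1 i + \<alpha>2 i) (\<lambda>j. \<beta>1 j + \<beta>2 j) = comb \<alpha>' \<beta>'"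
    using assms(1) A B by (simp add: comb_add)
  then have eq: "\<And>i. i \<le> k \<Longrightarrow> \<alpha>1 i + \<alpha>2 i = \<alpha>' i" "\<And>j. j \<le> t \<Longrightarrow> \<beta>1 j + \<beta>2 j = \<beta>' j"
    using comb_unique[of p \<alpha>' q \<beta>'] assms by auto
  have "(\<Sum>i=0..k. \<alpha>1 i) + (\<Sum>j=0..t. \<beta>1 j) + ((\<Sum>i=0..k. \<alpha>2 i) + (\<Sum>j=0..t. \<beta>2 j)) =
      (\<Sum>i=0..k. \<alpha>1 i + \<alpha>2 i) + (\<Sum>j=0..t. \<beta>1 j + \<beta>2 j)"
    by (simp add: sum.distrib)
  also have "\<dots> = 1"
    using assms(8) eq by (simp cong: sum.cong_simp)
  finally have "(\<Sum>i=0..k. \<alpha>1 i) + (\<Sum>j=0..t. \<beta>1 j) = 0 \<or> (\<Sum>i=0..k. \<alpha>2 i) + (\<Sum>j=0..t. \<beta>2 j) = 0"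
    by linarith
  moreover have "comb \<alpha> \<beta> = {#}" if "(\<Sum>i=0..k. \<alpha> i) + (\<Sum>j=0..t. \<beta> j) = 0" for \<alpha> \<beta>
    using that comb_cong[of \<alpha> "\<lambda>_. 0" \<beta> "\<lambda>_. 0"] by (simp add: comb_zero)
  ultimately show ?thesis using A B by auto
qed

lemma comb_upd_U: "i \<le> k \<Longrightarrow> U i + comb \<alpha> \<beta> = comb (\<alpha>(i := Suc (\<alpha> i))) \<beta>"
  by (auto simp: U_eq_comb comb_add intro!: comb_cong)

lemma comb_upd_V: "j \<le> t \<Longrightarrow> V j + comb \<alpha> \<beta> = comb \<alpha> (\<beta>(j := Suc (\<beta> j)))"
  by (auto simp: V_eq_comb comb_add intro!: comb_cong)

lemma sum_fun_upd_Suc: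
  "i \<le> (n::nat) \<Longrightarrow> (\<Sum>p=0..n. (f(i := Suc (f i))) p) = Suc (\<Sum>p=0..n. f p)"
  by (simp add: sum.remove[of _ i])

text \<open>Used twice: to see that there are no further atoms, and as the induction step for
  lengths.\<close>

lemma comb_peel:
  assumes "(\<Sum>i=0..k. \<alpha> i) + (\<Sum>j=0..t. \<beta> j) = Suc n"
  shows "\<exists>\<alpha>' \<beta>'. (\<Sum>i=0..k. \<alpha>' i) + (\<Sum>j=0..t. \<beta>' j) = n \<and>
    (\<exists>W\<in>U ` {0..k} \<union> V ` {0..t}. comb \<alpha> \<beta> = W + comb \<alpha>' \<beta>')"
proof -
  have "(\<exists>i\<le>k. \<alpha> i > 0) \<or> (\<exists>j\<le>t. \<beta> j > 0)"
  proof (rule ccontr)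
    assume "\<not> ?thesis"
    then show False using assms by simp
  qed
  then show ?thesis
  proof (elim disjE exE conjE)
    fix i assume i: "i \<le> k" "\<alpha> i > 0"
    let ?a = "\<alpha>(i := \<alpha> i - 1)"
    have \<alpha>: "\<alpha> = ?a(i := Suc (?a i))" using i by auto
    have "comb \<alpha> \<beta> = U i + comb ?a \<beta>"
      by (subst \<alpha>) (rule comb_upd_U[OF i(1), symmetric])
    moreover have "(\<Sum>i=0..k. \<alpha> i) = Suc (\<Sum>i=0..k. ?a i)"
      by (subst \<alpha>) (rule sum_fun_upd_Suc[OF i(1)])
    ultimately show ?thesis
      using i assms by (intro exI[of _ ?a] exI[of _ \<beta>] conjI bexI[of _ "U i"]) auto
  next
    fix j assume j: "j \<le> t" "\<beta> j > 0"
    let ?b = "\<beta>(j := \<beta> j - 1)"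
    have \<beta>: "\<beta> = ?b(j := Suc (?b j))" using j by auto
    have "comb \<alpha> \<beta> = V j + comb \<alpha> ?b"
      by (subst \<beta>) (rule comb_upd_V[OF j(1), symmetric])
    moreover have "(\<Sum>j=0..t. \<beta> j) = Suc (\<Sum>j=0..t. ?b j)"
      by (subst \<beta>) (rule sum_fun_upd_Suc[OF j(1)])
    ultimately show ?thesis
      using j assms by (intro exI[of _ \<alpha>] exI[of _ ?b] conjI bexI[of _ "V j"]) auto
  qed
qed

lemma U_atom: assumes "i \<le> k" shows "U i \<in> atoms M"
proof -
  interpret comm_monoid_cancel M by (rule M_cancel)
  obtain p where p: "p \<le> k" "p \<noteq> i" using ex_other_row by blast
  have "count (U i) (e i 0) \<noteq> 0" using assms s_pos[of 0] by (simp add: count_U)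
  then have "U i \<noteq> {#}" by auto
  moreover have "A = {#} \<or> B = {#}" if "A \<in> Z" "B \<in> Z" "U i = A + B" for A B
    using that assms p s_pos[of 0]
    by (intro comb_split_trivial[of "\<lambda>p. if p = i then 1 else 0" "\<lambda>_. 0" A B p 0]) (simp_all add: U_eq_comb)
  ultimately show ?thesis
    unfolding atoms_alt_def Units_M using comb_in_Z assms by (auto simp: U_eq_comb)
qed

lemma V_atom: assumes "j \<le> t" shows "V j \<in> atoms M"
proof -
  interpret comm_monoid_cancel M by (rule M_cancel)
  obtain q where q: "q \<le> t" "(if q = j then 1 else 0) < s q" using ex_gap_column by blast
  have "count (V j) (e 0 j) \<noteq> 0" using assms by (simp add: count_V)
  then have "V j \<noteq> {#}" by auto
  moreover have "A = {#} \<or> B = {#}" if "A \<in> Z" "B \<in> Z" "V j = A + B" for A B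
    using that assms q
    by (intro comb_split_trivial[of "\<lambda>_. 0" "\<lambda>q. if q = j then 1 else 0" A B 0 q]) (simp_all add: V_eq_comb)
  ultimately show ?thesis
    unfolding atoms_alt_def Units_M using comb_in_Z assms by (auto simp: V_eq_comb)
qed

text \<open>Every nonempty zero-sum sequence has some \<open>U i\<close> or \<open>V j\<close> as a
  factor; if it is an atom, the cofactor must be empty.\<close>

lemma atoms_M: "atoms M = U ` {0..k} \<union> V ` {0..t}"
proof -
  interpret comm_monoid_cancel M by (rule M_cancel)
  have "A \<in> U ` {0..k} \<union> V ` {0..t}" if A: "A \<in> atoms M" for A
  proof -
    have irr: "A \<noteq> {#}" "\<And>B D. B \<in> Z \<Longrightarrow> D \<in> Z \<Longrightarrow> A = B + D \<Longrightarrow> B = {#} \<or> D = {#}"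
      using A by (auto simp: atoms_alt_def Units_M)
    obtain \<alpha> \<beta> where \<alpha>\<beta>: "A = comb \<alpha> \<beta>" using A atoms_closed[of A M] by (auto simp: Z_comb_ex)
    have "(\<Sum>i=0..k. \<alpha> i) + (\<Sum>j=0..t. \<beta> j) \<noteq> 0"
      using irr(1) \<alpha>\<beta> comb_cong[of \<alpha> "\<lambda>_. 0" \<beta> "\<lambda>_. 0"] by (simp add: comb_zero) force
    then obtain n where "(\<Sum>i=0..k. \<alpha> i) + (\<Sum>j=0..t. \<beta> j) = Suc n" by (meson not0_implies_Suc)
    from comb_peel[OF this] obtain W \<alpha>' \<beta>'
      where W: "W \<in> U ` {0..k} \<union> V ` {0..t}" "A = W + comb \<alpha>' \<beta>'"
      unfolding \<alpha>\<beta> by blast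
    then have "W \<in> atoms M" using U_atom V_atom by auto
    then have "W \<in> Z" "W \<noteq> {#}" by (auto simp: atoms_alt_def Units_M)
    with irr(2)[OF _ _ W(2)] W comb_in_Z show ?thesis by auto
  qed
  then show ?thesis using U_atom V_atom by auto
qed

text \<open>Lengths become total exponents, so finding all lengths of \<open>B\<close> amounts to
  listing all pairs \<open>\<alpha>\<close>, \<open>\<beta>\<close> with
  \<open>B = comb \<alpha> \<beta>\<close>.\<close>

lemma mem_atom_prods_M:
  "B \<in> atom_prods M n \<longleftrightarrow> (\<exists>\<alpha> \<beta>. B = comb \<alpha> \<beta> \<and> (\<Sum>i=0..k. \<alpha> i) + (\<Sum>j=0..t. \<beta> j) = n)"
proof (induction n arbitrary: B)
  case 0
  have "comb \<alpha> \<beta> = {#}" if "(\<Sum>i=0..k. \<alpha> i) + (\<Sum>j=0..t. \<beta> j) = 0" for \<alpha> \<beta>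
    using that comb_cong[of \<alpha> "\<lambda>_. 0" \<beta> "\<lambda>_. 0"] by (simp add: comb_zero)
  then show ?case
    unfolding atom_prods.simps Units_M
    by (auto intro!: exI[of _ "\<lambda>_. 0"] simp: comb_zero)
next
  case (Suc n)
  show ?case
  proof
    assume "B \<in> atom_prods M (Suc n)"
    then obtain W D where WD: "W \<in> U ` {0..k} \<union> V ` {0..t}" "B = W + D" "D \<in> atom_prods M n"
      unfolding mem_atom_prods_Suc atoms_M M_simps by blast
    then obtain \<alpha> \<beta> where W: "D = comb \<alpha> \<beta>" "(\<Sum>i=0..k. \<alpha> i) + (\<Sum>j=0..t. \<beta> j) = n"
      unfolding Suc.IH by blast
    note W = WD(1,2) W
    then show "\<exists>\<alpha> \<beta>. B = comb \<alpha> \<beta> \<and> (\<Sum>i=0..k. \<alpha> i) + (\<Sum>j=0..t. \<beta> j) = Suc n"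
    proof (elim UnE imageE)
      fix i assume "W = U i" "i \<in> {0..k}"
      with W show ?thesis using comb_upd_U[of i \<alpha> \<beta>] sum_fun_upd_Suc[of i k \<alpha>]
        by (intro exI[of _ "\<alpha>(i := Suc (\<alpha> i))"] exI[of _ \<beta>]) auto
    next
      fix j assume "W = V j" "j \<in> {0..t}"
      with W show ?thesis using comb_upd_V[of j \<alpha> \<beta>] sum_fun_upd_Suc[of j t \<beta>]
        by (intro exI[of _ \<alpha>] exI[of _ "\<beta>(j := Suc (\<beta> j))"]) auto
    qed
  next
    assume "\<exists>\<alpha> \<beta>. B = comb \<alpha> \<beta> \<and> (\<Sum>i=0..k. \<alpha> i) + (\<Sum>j=0..t. \<beta> j) = Suc n"
    then obtain \<alpha> \<beta> where B: "B = comb \<alpha> \<beta>" "(\<Sum>i=0..k. \<alpha> i) + (\<Sum>j=0..t. \<beta> j) = Suc n" by blast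
    from comb_peel[OF B(2)] obtain W \<alpha>' \<beta>' where "(\<Sum>i=0..k. \<alpha>' i) + (\<Sum>j=0..t. \<beta>' j) = n"
      "W \<in> U ` {0..k} \<union> V ` {0..t}" "B = W + comb \<alpha>' \<beta>'"
      unfolding B(1) by blast
    moreover from this have "comb \<alpha>' \<beta>' \<in> atom_prods M n" unfolding Suc.IH by blast
    ultimately show "B \<in> atom_prods M (Suc n)"
      unfolding mem_atom_prods_Suc atoms_M M_simps by blast
  qed
qed

section \<open>Sets of lengths and normal forms\<close>

text \<open>\<open>comb_reduced_eq_iff\<close> lists the representations by \<open>\<nu>\<close>. Of
  the \<open>x\<close> copies of the relation, \<open>\<nu>\<close> are taken as the product of all
  \<open>U i\<close>, at \<open>k + 1\<close> atoms each, and the other \<open>x - \<nu>\<close> as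
  powers of the \<open>V j\<close>, at as many atoms as the entries of \<open>s\<close> add up
  to.\<close>

lemma length_set_comb:
  assumes "p \<le> k" "y p = 0" "q \<le> t" "z q < s q"
  shows "length_set M (comb y (\<lambda>j. z j + x * s j)) =
    (\<lambda>\<nu>. (\<Sum>i=0..k. y i) + (\<Sum>j=0..t. z j) + (\<nu> * (k + 1) + (x - \<nu>) * (\<Sum>j=0..t. s j))) ` {0..x}"
proof -
  interpret comm_monoid_cancel M by (rule M_cancel)
  have 1: "n \<in> length_set M (comb y (\<lambda>j. z j + x * s j)) \<longleftrightarrow>
      (\<exists>\<alpha> \<beta>. comb \<alpha> \<beta> = comb y (\<lambda>j. z j + x * s j) \<and> (\<Sum>i=0..k. \<alpha> i) + (\<Sum>j=0..t. \<beta> j) = n)" for n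
    using comb_in_Z
    by (simp add: length_set_eq mem_atom_prods_M eq_commute[of "comb y (\<lambda>j. z j + x * s j)"])
  have 2: "(\<exists>\<alpha> \<beta>. comb \<alpha> \<beta> = comb y (\<lambda>j. z j + x * s j) \<and> (\<Sum>i=0..k. \<alpha> i) + (\<Sum>j=0..t. \<beta> j) = n) \<longleftrightarrow> (\<exists>\<nu>\<le>x. (\<Sum>i=0..k. y i + \<nu>) + (\<Sum>j=0..t. z j + (x - \<nu>) * s j) = n)" for n
  proof
    assume "\<exists>\<nu>\<le>x. (\<Sum>i=0..k. y i + \<nu>) + (\<Sum>j=0..t. z j + (x - \<nu>) * s j) = n"
    then obtain \<nu> where "\<nu> \<le> x" "(\<Sum>i=0..k. y i + \<nu>) + (\<Sum>j=0..t. z j + (x - \<nu>) * s j) = n" by blast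
    then show "\<exists>\<alpha> \<beta>. comb \<alpha> \<beta> = comb y (\<lambda>j. z j + x * s j) \<and> (\<Sum>i=0..k. \<alpha> i) + (\<Sum>j=0..t. \<beta> j) = n"
      unfolding comb_reduced_eq_iff[of p y q z, OF assms]
      by (intro exI[of _ "\<lambda>i. y i + \<nu>"] exI[of _ "\<lambda>j. z j + (x - \<nu>) * s j"]) auto
  next
    assume "\<exists>\<alpha> \<beta>. comb \<alpha> \<beta> = comb y (\<lambda>j. z j + x * s j) \<and> (\<Sum>i=0..k. \<alpha> i) + (\<Sum>j=0..t. \<beta> j) = n"
    then obtain \<alpha> \<beta> \<nu> where "\<nu> \<le> x" "\<And>i. i \<le> k \<Longrightarrow> \<alpha> i = y i + \<nu>"
        "\<And>j. j \<le> t \<Longrightarrow> \<beta> j = z j + (x - \<nu>) * s j" "(\<Sum>i=0..k. \<alpha> i) + (\<Sum>j=0..t. \<beta> j) = n"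
      unfolding comb_reduced_eq_iff[of p y q z, OF assms] by blast
    then show "\<exists>\<nu>\<le>x. (\<Sum>i=0..k. y i + \<nu>) + (\<Sum>j=0..t. z j + (x - \<nu>) * s j) = n"
      by (intro exI[of _ \<nu>]) (simp cong: sum.cong_simp)
  qed
  have 3: "(\<Sum>i=0..k. y i + \<nu>) + (\<Sum>j=0..t. z j + (x - \<nu>) * s j) =
      (\<Sum>i=0..k. y i) + (\<Sum>j=0..t. z j) + (\<nu> * (k + 1) + (x - \<nu>) * (\<Sum>j=0..t. s j))" for \<nu>
    by (simp add: sum.distrib flip: sum_distrib_left)
  show ?thesis
    by (rule Set.set_eqI) (unfold 1 2 3, auto)
qed

text \<open>The block with exponent \<open>x\<close> is moved to the side of the \<open>V j\<close>,
  so that a row with \<open>y p = 0\<close> keeps exponent 0, as \<open>comb_reduced_eq_iff\<close>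
  demands.\<close>

lemma comb_shift:
  "repeat_mset x (\<Sum>i=0..k. U i) + (\<Sum>i=0..k. repeat_mset (y i) (U i)) + (\<Sum>j=0..t. repeat_mset (z j) (V j))
    = comb y (\<lambda>j. z j + x * s j)"
proof -
  have "repeat_mset x (\<Sum>i=0..k. U i) = comb (\<lambda>_. 0) (\<lambda>j. x * s j)"
    unfolding U_sum_eq comb_def
    by (simp add: comb_def) (induction x, simp_all add: sum.distrib repeat_mset_distrib)
  moreover have "(\<Sum>i=0..k. repeat_mset (y i) (U i)) + (\<Sum>j=0..t. repeat_mset (z j) (V j)) = comb y z"
    by (simp add: comb_def)
  ultimately show ?thesis by (simp add: comb_add add.assoc) (simp add: add.commute)
qed

text \<open>The extensional function spaces fix \<open>y\<close> and \<open>z\<close> outside their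
  index ranges, where the equation for \<open>B\<close> says nothing about them.\<close>

lemma ex1_normal_form:
  assumes "B \<in> Z"
  shows "\<exists>!(x, y, z). y \<in> {0..k} \<rightarrow>\<^sub>E UNIV \<and> z \<in> {0..t} \<rightarrow>\<^sub>E UNIV \<and> B = comb y (\<lambda>j. z j + x * s j) \<and>
    (\<exists>i\<in>{0..k}. y i = 0) \<and> (\<exists>j\<in>{0..t}. z j < s j)"
proof -
  let ?P = "\<lambda>x y z. y \<in> {0..k} \<rightarrow>\<^sub>E UNIV \<and> z \<in> {0..t} \<rightarrow>\<^sub>E UNIV \<and> B = comb y (\<lambda>j. z j + x * s j) \<and>
    (\<exists>i\<in>{0..k}. y i = 0) \<and> (\<exists>j\<in>{0..t}. z j < s j)"
  obtain x y z where xyz: "?P x y z"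
  proof -
    obtain \<alpha> \<beta> p where B: "B = comb \<alpha> \<beta>" "p \<le> k" "\<alpha> p = 0" using Z_comb[OF assms] by blast
    \<comment> \<open>The largest number of copies of \<open>s\<close> contained in
      \<open>\<beta>\<close>. At a column \<open>q\<close> where the quotient is least, the
      remainder falls below \<open>s q\<close>.\<close>
    define x where "x = Min ((\<lambda>j. \<beta> j div s j) ` {0..t})"
    have x: "x \<le> \<beta> j div s j" if "j \<le> t" for j unfolding x_def using that by auto
    have "x \<in> (\<lambda>j. \<beta> j div s j) ` {0..t}" unfolding x_def by (rule Min_in) auto
    then obtain q where q: "q \<le> t" "x = \<beta> q div s q" by auto
    have le: "x * s j \<le> \<beta> j" if "j \<le> t" for j
      using x[OF that] s_pos[OF that] by (simp add: less_eq_div_iff_mult_less_eq)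
    have "\<beta> q - x * s q < s q"
      using q s_pos[OF q(1)] by (simp add: minus_div_mult_eq_mod)
    moreover have "comb \<alpha> \<beta> = comb (restrict \<alpha> {0..k})
       (\<lambda>j. restrict (\<lambda>j. \<beta> j - x * s j) {0..t} j + x * s j)"
      using le by (intro comb_cong) auto
    ultimately have "?P x (restrict \<alpha> {0..k}) (restrict (\<lambda>j. \<beta> j - x * s j) {0..t})"
      using B q by auto
    then show ?thesis by (rule that)
  qed
  have uniq: "x' = x \<and> y' = y \<and> z' = z" if P: "?P x y z" and P': "?P x' y' z'" for x y z x' y' z'
  proof -
    obtain p q where pq: "p \<le> k" "y p = 0" "q \<le> t" "z q < s q" using P by auto
    obtain p' q' where pq': "p' \<le> k" "y' p' = 0" "q' \<le> t" "z' q' < s q'" using P' by auto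
    have "comb y' (\<lambda>j. z' j + x' * s j) = comb y (\<lambda>j. z j + x * s j)" using P P' by simp
    then obtain \<nu> where \<nu>: "\<nu> \<le> x" "\<And>i. i \<le> k \<Longrightarrow> y' i = y i + \<nu>"
        "\<And>j. j \<le> t \<Longrightarrow> z' j + x' * s j = z j + (x - \<nu>) * s j"
      unfolding comb_reduced_eq_iff[of p y q z, OF pq] by blast
    \<comment> \<open>In the row \<open>p'\<close>, where \<open>y'\<close> vanishes, the equation
      reads \<open>0 = y p' + \<nu>\<close>. What remains is a comparison of columns: the small
      remainders at \<open>q\<close> and at \<open>q'\<close> give the two inequalities between
      \<open>x\<close> and \<open>x'\<close>.\<close>
    have "\<nu> = 0" using \<nu>(2)[OF pq'(1)] pq' by simp
    have eq: "z' j + x' * s j = z j + x * s j" if "j \<le> t" for j using \<nu>(3)[OF that] \<open>\<nu> = 0\<close> by simp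
    have "x' * s q < (x + 1) * s q" using eq[OF pq(3)] pq(4) by simp
    then have "x' \<le> x" by (metis mult_less_cancel2 less_Suc_eq_le Suc_eq_plus1)
    moreover have "x * s q' < (x' + 1) * s q'" using eq[OF pq'(3)] pq'(4) by simp
    then have "x \<le> x'" by (metis mult_less_cancel2 less_Suc_eq_le Suc_eq_plus1)
    ultimately have x: "x' = x" by simp
    have "y' i = y i" for i
      using \<nu>(2)[of i] \<open>\<nu> = 0\<close> P P' by (cases "i \<le> k") (auto simp: PiE_def extensional_def)
    moreover have "z' j = z j" for j
      using eq[of j] x P P' by (cases "j \<le> t") (auto simp: PiE_def extensional_def)
    ultimately show ?thesis using x by auto
  qed
  show ?thesis
  proof (rule ex1I[of _ "(x, y, z)"])
    show "case (x, y, z) of (x, y, z) \<Rightarrow> ?P x y z" using xyz by simp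
    fix w assume w: "case w of (x, y, z) \<Rightarrow> ?P x y z"
    obtain x' y' z' where "w = (x', y', z')" by (cases w)
    with w uniq[OF xyz, where x' = x' and y' = y' and z' = z'] show "w = (x, y, z)" by simp
  qed
qed

section \<open>The inclusion as a divisor theory\<close>

text \<open>Cofactors stay zero-sum because the matrix shape, with integer \<open>a\<close> and
  \<open>c\<close>, is closed under differences. For the greatest common divisors, one zero-sum
  sequence per row is enough.\<close>

lemma divisor_theory_M: "divisor_theory M G0 (\<lambda>B. B)"
  unfolding divisor_theory_def
proof (intro conjI ballI)
  have div: "a divides\<^bsub>M\<^esub> b" if a: "a \<in> Z" and b: "b \<in> Z" and ab: "a divides\<^bsub>free_monoid G0\<^esub> b" for a b
  proof -
    from ab obtain d where d: "set_mset d \<subseteq> G0" "b = a + d" by (auto simp: factor_def)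
    obtain f c f' c' where fc: "\<And>i j. i \<le> k \<Longrightarrow> j \<le> t \<Longrightarrow> int (count a (e i j)) = f j + c i * int (s j)"
      "\<And>i j. i \<le> k \<Longrightarrow> j \<le> t \<Longrightarrow> int (count b (e i j)) = f' j + c' i * int (s j)"
      using a b unfolding mem_Z_iff by blast
    have "int (count d (e i j)) = (f' j - f j) + (c' i - c i) * int (s j)" if "i \<le> k" "j \<le> t" for i j
      using fc[OF that] d(2) by (simp add: algebra_simps)
    then have "d \<in> Z" unfolding mem_Z_iff using d(1)
      by (intro conjI exI[of _ "\<lambda>j. f' j - f j"] exI[of _ "\<lambda>i. c' i - c i"]) auto
    then show ?thesis using d by (auto simp: factor_def)
  qed
  show "divisor_hom M (free_monoid G0) (\<lambda>B. B)"
    unfolding divisor_hom_def hom_def using div by (auto simp: mem_Z_iff)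
  fix d assume "d \<in> carrier (free_monoid G0)"
  then have d: "set_mset d \<subseteq> G0" by simp
  \<comment> \<open>\<open>E i\<close> agrees with \<open>d\<close> in row \<open>i\<close> and dominates it in every other row.\<close>
  define E where "E i = comb (\<lambda>p. if p = i then 0 else (\<Sum>j=0..t. count d (e p j))) (\<lambda>j. count d (e i j))" for i
  have count_E: "count (E i) (e p q) = (if p = i then 0 else (\<Sum>j=0..t. count d (e p j))) * s q + count d (e i q)"
    if "p \<le> k" "q \<le> t" for i p q
    unfolding E_def using that by (simp add: count_comb)
  have dE: "d \<subseteq># E i" if "i \<le> k" for i
  proof (rule mset_subset_eqI)
    fix x show "count d x \<le> count (E i) x"
    proof (cases "x \<in> G0")
      case True
      then obtain p q where x: "x = e p q" "p \<le> k" "q \<le> t" by (auto simp: G0_eq)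
      \<comment> \<open>A row total bounds every entry of its row, so it is a multiplier that works
        for all columns at once; \<open>s q \<ge> 1\<close> preserves the bound.\<close>
      have "count d (e p q) \<le> (\<Sum>j=0..t. count d (e p j))"
        using x by (intro member_le_sum) auto
      also have "\<dots> \<le> (\<Sum>j=0..t. count d (e p j)) * s q" using s_pos[OF x(3)] by simp
      finally show ?thesis using x count_E[of p q i] by auto
    next
      case False
      then show ?thesis using d by (metis count_inI le0 subsetD)
    qed
  qed
  have glb: "y \<subseteq># d" if y: "\<And>i. i \<le> k \<Longrightarrow> y \<subseteq># E i" for y
  proof (rule mset_subset_eqI)
    fix x show "count y x \<le> count d x"
    proof (cases "x \<in> G0")
      case True
      then obtain p q where x: "x = e p q" "p \<le> k" "q \<le> t" by (auto simp: G0_eq)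
      then show ?thesis using mset_subset_eq_count[OF y[OF x(2)], of "e p q"] count_E[of p q p] by simp
    next
      case False
      then have "count (E 0) x = 0" using set_comb unfolding E_def by (metis count_inI subsetD)
      then show ?thesis using mset_subset_eq_count[OF y[of 0], of x] by simp
    qed
  qed
  have sE: "set_mset (E i) \<subseteq> G0" for i unfolding E_def by (rule set_comb)
  show "\<exists>A\<subseteq>carrier M. finite A \<and> A \<noteq> {} \<and>
       greatest (division_rel (free_monoid G0)) d (Lower (division_rel (free_monoid G0)) ((\<lambda>B. B) ` A))"
  proof (intro exI[of _ "E ` {0..k}"] conjI)
    show "E ` {0..k} \<subseteq> carrier M" unfolding E_def using comb_in_Z by auto
    show "greatest (division_rel (free_monoid G0)) d (Lower (division_rel (free_monoid G0)) ((\<lambda>B. B) ` (E ` {0..k})))"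
    proof -
      have "Lower (division_rel (free_monoid G0)) (E ` {0..k}) = {y. set_mset y \<subseteq> G0 \<and> (\<forall>i\<le>k. y \<subseteq># E i)}"
        using sE by (auto simp: Lower_def free_monoid_divides_iff)
      then show ?thesis
        unfolding greatest_def image_ident using d dE glb by (simp add: free_monoid_divides_iff subset_iff)
    qed
  qed auto
qed

end

section \<open>Quotient groups and class groups\<close>

lemma (in comm_monoid_cancel) equiv_frac_rel: "equiv (carrier G \<times> carrier G) (frac_rel G)"
proof (rule equivI)
  show "trans (frac_rel G)"
  proof (rule transI, clarify)
    fix a b c d f h
    assume 1: "((a, b), (c, d)) \<in> frac_rel G" and 2: "((c, d), (f, h)) \<in> frac_rel G"
    then have c: "a \<in> carrier G" "b \<in> carrier G" "c \<in> carrier G" "d \<in> carrier G" "f \<in> carrier G" "h \<in> carrier G"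
      and eq: "a \<otimes> d = c \<otimes> b" "c \<otimes> h = f \<otimes> d" by (auto simp: frac_rel_def)
    have "(a \<otimes> h) \<otimes> d = (a \<otimes> d) \<otimes> h" using c by (simp add: m_ac)
    also have "\<dots> = (c \<otimes> h) \<otimes> b" using c by (simp add: eq(1) m_ac)
    also have "\<dots> = (f \<otimes> b) \<otimes> d" using c by (simp add: eq(2) m_ac)
    finally have "a \<otimes> h = f \<otimes> b" by (rule r_cancel) (use c in auto)
    then show "((a, b), (f, h)) \<in> frac_rel G" using c by (auto simp: frac_rel_def)
  qed
qed (auto simp: frac_rel_def refl_on_def sym_def)

lemma (in comm_monoid_cancel) fraction_eq_iff:
  assumes "a \<in> carrier G" "b \<in> carrier G" "c \<in> carrier G" "d \<in> carrier G"
  shows "fraction G a b = fraction G c d \<longleftrightarrow> a \<otimes> d = c \<otimes> b"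
  unfolding fraction_def
  by (subst eq_equiv_class_iff[OF equiv_frac_rel]) (use assms in \<open>auto simp: frac_rel_def\<close>)

lemma carrier_quotient_group:
  "carrier (quotient_group G) = {fraction G a b | a b. a \<in> carrier G \<and> b \<in> carrier G}"
  by (auto simp: quotient_group_def quotient_def fraction_def)

lemma (in comm_monoid_cancel) mem_fractionD:
  assumes "x \<in> fraction G a b" "a \<in> carrier G" "b \<in> carrier G"
  shows "fst x \<in> carrier G" "snd x \<in> carrier G" "fraction G (fst x) (snd x) = fraction G a b"
proof -
  have *: "((a, b), x) \<in> frac_rel G" using assms(1) by (simp add: fraction_def)
  then show "fst x \<in> carrier G" "snd x \<in> carrier G" by (auto simp: frac_rel_def)
  show "fraction G (fst x) (snd x) = fraction G a b"
    using equiv_class_eq[OF equiv_frac_rel *] by (simp add: fraction_def)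
qed

lemma (in comm_monoid_cancel) mem_fraction_self:
  "a \<in> carrier G \<Longrightarrow> b \<in> carrier G \<Longrightarrow> (a, b) \<in> fraction G a b"
  by (simp add: fraction_def frac_rel_def)

text \<open>The product in \<open>quotient_group\<close> is a union over all pairs of
  representatives. It is a single fraction because every pair yields the same one and at least one
  pair exists.\<close>

lemma (in comm_monoid_cancel) mult_fraction:
  assumes "a \<in> carrier G" "b \<in> carrier G" "c \<in> carrier G" "d \<in> carrier G"
  shows "fraction G a b \<otimes>\<^bsub>quotient_group G\<^esub> fraction G c d = fraction G (a \<otimes> c) (b \<otimes> d)"
proof -
  have "fraction G (fst x \<otimes> fst y) (snd x \<otimes> snd y) = fraction G (a \<otimes> c) (b \<otimes> d)"
    if x: "x \<in> fraction G a b" and y: "y \<in> fraction G c d" for x y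
  proof -
    have c: "fst x \<in> carrier G" "snd x \<in> carrier G" "fst y \<in> carrier G" "snd y \<in> carrier G"
      using mem_fractionD[OF x] mem_fractionD[OF y] assms by auto
    have eq: "fst x \<otimes> b = a \<otimes> snd x" "fst y \<otimes> d = c \<otimes> snd y"
      using mem_fractionD(3)[OF x] mem_fractionD(3)[OF y] assms c by (auto simp: fraction_eq_iff)
    have "(fst x \<otimes> fst y) \<otimes> (b \<otimes> d) = (fst x \<otimes> b) \<otimes> (fst y \<otimes> d)" using c assms by (simp add: m_ac)
    also have "\<dots> = (a \<otimes> c) \<otimes> (snd x \<otimes> snd y)" unfolding eq using c assms by (simp add: m_ac)
    finally show ?thesis using c assms by (simp add: fraction_eq_iff)
  qed
  moreover have "fraction G a b \<noteq> {}" "fraction G c d \<noteq> {}"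
    using mem_fraction_self assms by blast+
  ultimately show ?thesis
    by (simp add: quotient_group_def)
qed

lemma one_quotient_group: "\<one>\<^bsub>quotient_group G\<^esub> = fraction G \<one>\<^bsub>G\<^esub> \<one>\<^bsub>G\<^esub>"
  by (simp add: quotient_group_def)

lemma (in comm_monoid_cancel) quotient_group_comm_group: "comm_group (quotient_group G)"
proof (rule comm_groupI)
  fix x assume "x \<in> carrier (quotient_group G)"
  then obtain a b where ab: "x = fraction G a b" "a \<in> carrier G" "b \<in> carrier G"
    unfolding carrier_quotient_group by blast
  then have "fraction G b a \<otimes>\<^bsub>quotient_group G\<^esub> x = \<one>\<^bsub>quotient_group G\<^esub>"
    by (simp add: mult_fraction one_quotient_group fraction_eq_iff m_comm)
  then show "\<exists>y\<in>carrier (quotient_group G). y \<otimes>\<^bsub>quotient_group G\<^esub> x = \<one>\<^bsub>quotient_group G\<^esub>"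
    unfolding carrier_quotient_group using ab by blast
qed (auto simp: carrier_quotient_group one_quotient_group mult_fraction m_ac, (metis m_closed one_closed)+)

lemma subgroup_quotient_subgroup:
  assumes "monoid M" and \<phi>: "\<phi> \<in> hom M (free_monoid P)" "\<phi> \<one>\<^bsub>M\<^esub> = {#}"
  shows "subgroup (quotient_subgroup M P \<phi>) (quotient_group (free_monoid P))"
proof -
  interpret M: monoid M by fact
  interpret F: comm_monoid_cancel "free_monoid P" by (rule free_monoid_cancel)
  interpret Q: comm_group "quotient_group (free_monoid P)" by (rule F.quotient_group_comm_group)
  let ?S = "quotient_subgroup M P \<phi>" and ?Q = "quotient_group (free_monoid P)"
  have c: "\<phi> a \<in> carrier (free_monoid P)" if "a \<in> carrier M" for a
    using \<phi> that unfolding hom_def by blast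
  have mult: "\<phi> (a \<otimes>\<^bsub>M\<^esub> b) = \<phi> a \<otimes>\<^bsub>free_monoid P\<^esub> \<phi> b" if "a \<in> carrier M" "b \<in> carrier M" for a b
    using \<phi> that by (simp add: hom_def)
  have mem: "fraction (free_monoid P) (\<phi> a) (\<phi> b) \<in> ?S" if "a \<in> carrier M" "b \<in> carrier M" for a b
    using that by (auto simp: quotient_subgroup_def)
  show ?thesis
  proof (rule Q.subgroupI)
    show "?S \<subseteq> carrier ?Q"
      unfolding carrier_quotient_group quotient_subgroup_def using c by blast
    show "?S \<noteq> {}" using mem M.one_closed by blast
    fix x assume "x \<in> ?S"
    then obtain a b where ab: "x = fraction (free_monoid P) (\<phi> a) (\<phi> b)" "a \<in> carrier M" "b \<in> carrier M"
      by (auto simp: quotient_subgroup_def)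
    have "fraction (free_monoid P) (\<phi> b) (\<phi> a) \<otimes>\<^bsub>?Q\<^esub> x = \<one>\<^bsub>?Q\<^esub>"
      using ab c[OF ab(2)] c[OF ab(3)]
      by (subst ab(1), subst F.mult_fraction)
         (auto simp: one_quotient_group F.fraction_eq_iff add.commute)
    then have "inv\<^bsub>?Q\<^esub> x = fraction (free_monoid P) (\<phi> b) (\<phi> a)"
      using ab c[OF ab(2)] c[OF ab(3)] by (intro Q.inv_equality) (auto simp: carrier_quotient_group)
    with mem ab show "inv\<^bsub>?Q\<^esub> x \<in> ?S" by simp
    fix y assume "y \<in> ?S"
    then obtain a' b' where ab': "y = fraction (free_monoid P) (\<phi> a') (\<phi> b')" "a' \<in> carrier M" "b' \<in> carrier M"
      by (auto simp: quotient_subgroup_def)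
    have "x \<otimes>\<^bsub>?Q\<^esub> y = fraction (free_monoid P) (\<phi> (a \<otimes>\<^bsub>M\<^esub> a')) (\<phi> (b \<otimes>\<^bsub>M\<^esub> b'))"
      unfolding ab(1) ab'(1) using ab ab' c by (simp only: F.mult_fraction mult)
    with mem ab ab' show "x \<otimes>\<^bsub>?Q\<^esub> y \<in> ?S" by simp
  qed
qed

lemma class_group_comm_group:
  assumes "monoid M" "divisor_theory M P \<phi>"
  shows "comm_group (class_group M P \<phi>)"
proof -
  interpret F: comm_monoid_cancel "free_monoid P" by (rule free_monoid_cancel)
  interpret Q: comm_group "quotient_group (free_monoid P)" by (rule F.quotient_group_comm_group)
  show ?thesis
    unfolding class_group_def
    using assms by (intro Q.abelian_FactGroup subgroup_quotient_subgroup)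
      (auto simp: divisor_theory_def divisor_hom_def)
qed

section \<open>The class group of a monoid of zero-sum sequences\<close>

lemma zero_sum_monoid_simps [simp]:
  "carrier (zero_sum_monoid G G0) = {S. set_mset S \<subseteq> G0 \<and> mset_prod G S = \<one>\<^bsub>G\<^esub>}"
  "x \<otimes>\<^bsub>zero_sum_monoid G G0\<^esub> y = x + y"
  "\<one>\<^bsub>zero_sum_monoid G G0\<^esub> = {#}"
  by (simp_all add: zero_sum_monoid_def free_monoid_def)

text \<open>The rest of a zero-sum sequence through \<open>g\<close> has the inverse of
  \<open>g\<close> as its product. So sequences over \<open>G0\<close> supply all inverses, and a
  complement of \<open>A\<close> is collected element by element.\<close>

lemma (in comm_group) zero_sum_complement:
  assumes "G0 \<subseteq> carrier G"
    and G0: "\<And>g. g \<in> G0 \<Longrightarrow> \<exists>S. set_mset S \<subseteq> G0 \<and> mset_prod G S = \<one> \<and> g \<in># S"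
    and "set_mset A \<subseteq> G0"
  shows "\<exists>T. set_mset T \<subseteq> G0 \<and> mset_prod G (A + T) = \<one>"
  using assms(3)
proof (induction A)
  case empty
  then show ?case by (intro exI[of _ "{#}"]) simp
next
  case (add g A)
  then obtain T where T: "set_mset T \<subseteq> G0" "mset_prod G (A + T) = \<one>" by auto
  obtain S where S: "set_mset S \<subseteq> G0" "mset_prod G S = \<one>" "g \<in># S" using G0[of g] add.prems by auto
  then obtain S' where S': "S = add_mset g S'" by (metis multi_member_split)
  have eq: "add_mset g A + (T + S') = (A + T) + S" using S' by simp
  have "mset_prod G (add_mset g A + (T + S')) = \<one>"
    unfolding eq using T S add.prems assms(1) by (subst mset_prod_union) auto
  then show ?case using T S S' by (intro exI[of _ "T + S'"]) auto
qed

text \<open>A quotient of two sequences with equal sums can be expanded by a common complement to a quotient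
  of zero-sum sequences.\<close>

lemma (in comm_group) class_group_zero_sum_monoid:
  assumes G0_sub: "G0 \<subseteq> carrier G"
    and G0: "\<And>g. g \<in> G0 \<Longrightarrow> \<exists>S. set_mset S \<subseteq> G0 \<and> mset_prod G S = \<one> \<and> g \<in># S"
    and gen: "generate G G0 = carrier G"
  shows "class_group (zero_sum_monoid G G0) G0 (\<lambda>B. B) \<cong> G"
proof -
  let ?F = "free_monoid G0" and ?Q = "quotient_group (free_monoid G0)"
  let ?B = "zero_sum_monoid G G0"
  interpret F: comm_monoid_cancel ?F by (rule free_monoid_cancel)
  interpret Q: comm_group ?Q by (rule F.quotient_group_comm_group)
  have sub: "set_mset A \<subseteq> carrier G" if "A \<in> carrier ?F" for A using that G0_sub by auto
  have pc: "mset_prod G A \<in> carrier G" if "A \<in> carrier ?F" for A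
    using sub[OF that] by (rule mset_prod_closed)
  \<comment> \<open>The value of a fraction in \<open>G\<close>, through a chosen representative;
    the fact that follows shows that the choice does not matter.\<close>
  define \<psi> where "\<psi> A = (case SOME x. x \<in> A of (a, b) \<Rightarrow> mset_prod G a \<otimes> inv mset_prod G b)" for A
  have \<psi>: "\<psi> (fraction ?F a b) = mset_prod G a \<otimes> inv mset_prod G b"
    if ab: "a \<in> carrier ?F" "b \<in> carrier ?F" for a b
  proof -
    have "(SOME x. x \<in> fraction ?F a b) \<in> fraction ?F a b"
      using F.mem_fraction_self[OF ab] by (rule someI)
    then obtain c d where cd: "(SOME x. x \<in> fraction ?F a b) = (c, d)" "(c, d) \<in> fraction ?F a b"
      by (metis surj_pair)
    have c: "c \<in> carrier ?F" "d \<in> carrier ?F" and "fraction ?F c d = fraction ?F a b"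
      using F.mem_fractionD[OF cd(2) ab] by auto
    then have "c + b = a + d" using ab by (simp add: F.fraction_eq_iff)
    then have eq: "mset_prod G c \<otimes> mset_prod G b = mset_prod G a \<otimes> mset_prod G d"
      using c ab sub by (metis mset_prod_union)
    note pcs = pc[OF ab(1)] pc[OF ab(2)] pc[OF c(1)] pc[OF c(2)]
    have "mset_prod G c \<otimes> inv mset_prod G d \<otimes> mset_prod G b = mset_prod G a \<otimes> mset_prod G d \<otimes> inv mset_prod G d"
      unfolding eq[symmetric] using pcs by (simp add: m_ac)
    then have "mset_prod G c \<otimes> inv mset_prod G d = mset_prod G a \<otimes> inv mset_prod G b"
      using pcs by (simp add: inv_solve_right m_assoc)
    then show ?thesis unfolding \<psi>_def cd(1) by simp
  qed
  have hom: "\<psi> \<in> hom ?Q G"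
  proof (rule homI)
    fix x assume "x \<in> carrier ?Q"
    then show "\<psi> x \<in> carrier G" using \<psi> pc unfolding carrier_quotient_group by auto
  next
    fix x y assume "x \<in> carrier ?Q" "y \<in> carrier ?Q"
    then obtain a b c d where ab: "x = fraction ?F a b" "a \<in> carrier ?F" "b \<in> carrier ?F"
      and cd: "y = fraction ?F c d" "c \<in> carrier ?F" "d \<in> carrier ?F"
      unfolding carrier_quotient_group by blast
    have "\<psi> (x \<otimes>\<^bsub>?Q\<^esub> y) = mset_prod G (a + c) \<otimes> inv mset_prod G (b + d)"
      unfolding ab(1) cd(1) using ab cd by (subst F.mult_fraction) (auto simp: \<psi>)
    also have "\<dots> = \<psi> x \<otimes> \<psi> y"
      using ab cd sub[OF ab(2)] sub[OF ab(3)] sub[OF cd(2)] sub[OF cd(3)]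
        pc[OF ab(2)] pc[OF ab(3)] pc[OF cd(2)] pc[OF cd(3)]
      by (simp add: \<psi> mset_prod_union inv_mult m_ac)
    finally show "\<psi> (x \<otimes>\<^bsub>?Q\<^esub> y) = \<psi> x \<otimes> \<psi> y" .
  qed
  interpret \<psi>: group_hom ?Q G \<psi>
    by (rule group_hom.intro) (use hom in \<open>auto intro!: group_hom_axioms.intro\<close>)
  have ker: "kernel ?Q G \<psi> = quotient_subgroup ?B G0 (\<lambda>B. B)"
  proof (intro equalityI subsetI)
    fix x assume x: "x \<in> kernel ?Q G \<psi>"
    then obtain a b where ab: "x = fraction ?F a b" "a \<in> carrier ?F" "b \<in> carrier ?F"
      unfolding kernel_def carrier_quotient_group by blast
    with x have "mset_prod G a \<otimes> inv mset_prod G b = \<one>" by (simp add: kernel_def \<psi>)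
    then have eq: "mset_prod G a = mset_prod G b"
      using pc[OF ab(2)] pc[OF ab(3)] by (metis inv_solve_right' l_one one_closed)
    obtain T where T: "set_mset T \<subseteq> G0" "mset_prod G (a + T) = \<one>"
      using zero_sum_complement[OF G0_sub G0, of a] ab by auto
    have "mset_prod G (b + T) = \<one>"
      using T eq sub[OF ab(2)] sub[OF ab(3)] G0_sub by (simp add: mset_prod_union)
    moreover have "x = fraction ?F (a + T) (b + T)"
      using ab T by (subst ab(1), subst F.fraction_eq_iff) auto
    ultimately show "x \<in> quotient_subgroup ?B G0 (\<lambda>B. B)"
      unfolding quotient_subgroup_def using T ab
      by (intro CollectI exI[of _ "a + T"] exI[of _ "b + T"]) auto
  next
    fix x assume "x \<in> quotient_subgroup ?B G0 (\<lambda>B. B)"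
    then obtain a b where "x = fraction ?F a b" "a \<in> carrier ?B" "b \<in> carrier ?B"
      unfolding quotient_subgroup_def by blast
    then show "x \<in> kernel ?Q G \<psi>"
      using \<psi>[of a b] unfolding kernel_def carrier_quotient_group by auto
  qed
  have "subgroup (\<psi> ` carrier ?Q) G" by (rule \<psi>.img_is_subgroup)
  moreover have "G0 \<subseteq> \<psi> ` carrier ?Q"
  proof
    fix g assume g: "g \<in> G0"
    then have "\<psi> (fraction ?F {#g#} {#}) = g" using G0_sub by (subst \<psi>) auto
    moreover have "fraction ?F {#g#} {#} \<in> carrier ?Q" using g unfolding carrier_quotient_group by force
    ultimately show "g \<in> \<psi> ` carrier ?Q" by (metis imageI)
  qed
  ultimately have "carrier G \<subseteq> \<psi> ` carrier ?Q"
    unfolding gen[symmetric] by (intro generate_subgroup_incl)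
  then have "\<psi> ` carrier ?Q = carrier G" using hom by (auto simp: hom_def)
  from \<psi>.FactGroup_iso[OF this] show ?thesis unfolding class_group_def ker .
qed

section \<open>Relations between the classes\<close>

lemma (in comm_group) finprod_int_pow_add:
  fixes a b :: "'i \<Rightarrow> int"
  assumes "x \<in> A \<rightarrow> carrier G"
  shows "finprod G (\<lambda>i. x i [^] (a i + b i)) A = finprod G (\<lambda>i. x i [^] a i) A \<otimes> finprod G (\<lambda>i. x i [^] b i) A"
proof -
  have "finprod G (\<lambda>i. x i [^] (a i + b i)) A = finprod G (\<lambda>i. x i [^] a i \<otimes> x i [^] b i) A"
    using assms by (intro finprod_cong') (auto simp: int_pow_mult Pi_iff)
  also have "\<dots> = finprod G (\<lambda>i. x i [^] a i) A \<otimes> finprod G (\<lambda>i. x i [^] b i) A"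
    using assms by (intro finprod_multf) (auto simp: Pi_iff)
  finally show ?thesis .
qed

lemma (in comm_group) finprod_int_pow:
  assumes "x \<in> A \<rightarrow> carrier G"
  shows "finprod G x A [^] (c::int) = finprod G (\<lambda>i. x i [^] c) A"
  using assms by (induction A rule: infinite_finite_induct) (auto simp: int_pow_distrib Pi_iff)

lemma (in comm_group) finprod_int_pow_mult:
  fixes a :: "'i \<Rightarrow> int"
  assumes "x \<in> A \<rightarrow> carrier G"
  shows "finprod G (\<lambda>i. x i [^] (a i * c)) A = finprod G (\<lambda>i. x i [^] a i) A [^] c"
  using assms by (subst finprod_int_pow) (auto simp: int_pow_pow Pi_iff intro!: finprod_cong')

lemma (in comm_group) finprod_swap:
  assumes "finite A" "finite B" "\<And>i j. i \<in> A \<Longrightarrow> j \<in> B \<Longrightarrow> f i j \<in> carrier G"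
  shows "finprod G (\<lambda>i. finprod G (f i) B) A = finprod G (\<lambda>j. finprod G (\<lambda>i. f i j) A) B"
  using assms(1,3)
proof (induction A)
  case empty
  then show ?case by simp
next
  case (insert a A)
  have "finprod G (\<lambda>j. finprod G (\<lambda>i. f i j) (insert a A)) B = finprod G (\<lambda>j. f a j \<otimes> finprod G (\<lambda>i. f i j) A) B"
    using insert by (intro finprod_cong') (auto simp: Pi_iff)
  also have "\<dots> = finprod G (f a) B \<otimes> finprod G (\<lambda>j. finprod G (\<lambda>i. f i j) A) B"
    using insert by (intro finprod_multf) (auto simp: Pi_iff intro!: finprod_closed)
  also have "finprod G (\<lambda>j. finprod G (\<lambda>i. f i j) A) B = finprod G (\<lambda>i. finprod G (f i) B) A"
    using insert by simp
  finally show ?case using insert by (subst finprod_insert) (auto simp: Pi_iff intro!: finprod_closed)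
qed

lemma (in comm_group) finprod_subgroup_generated:
  assumes "x \<in> A \<rightarrow> carrier (subgroup_generated G S)"
  shows "finprod (subgroup_generated G S) x A = finprod G x A"
proof -
  interpret D: comm_group "subgroup_generated G S"
    using abelian_subgroup_generated comm_group_axioms by blast
  have "carrier (subgroup_generated G S) \<subseteq> carrier G" by (rule carrier_subgroup_generated_subset)
  then show ?thesis using assms
    by (induction A rule: infinite_finite_induct) (auto simp: Pi_iff subset_iff)
qed

text \<open>An injective map sends \<open>y\<close> and the constant family \<open>\<one>\<close> to
  the same element. Both are restricted to \<open>I\<close>, as the elements of
  \<open>sum_group\<close> are extensional.\<close>

lemma (in comm_group) internal_direct_sum_trivial:
  assumes ids: "internal_direct_sum G I A" and "finite I"
    and A: "\<And>i. i \<in> I \<Longrightarrow> group (A i)" "\<And>i. i \<in> I \<Longrightarrow> \<one>\<^bsub>A i\<^esub> = \<one>"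
      "\<And>i. i \<in> I \<Longrightarrow> carrier (A i) \<subseteq> carrier G"
    and y: "\<And>i. i \<in> I \<Longrightarrow> y i \<in> carrier (A i)" and 1: "finprod G y I = \<one>" and "i \<in> I"
  shows "y i = \<one>"
proof -
  have inj: "inj_on (\<lambda>x. finprod G x I) (carrier (sum_group I A))"
    using ids by (simp add: internal_direct_sum_def iso_def bij_betw_def)
  have sg: "carrier (sum_group I A) = Pi\<^sub>E I (\<lambda>i. carrier (A i))"
    using A(1) \<open>finite I\<close> by (simp add: carrier_sum_group)
  have one: "\<one> \<in> carrier (A i)" if "i \<in> I" for i
    using A(1,2)[OF that] group.is_monoid monoid.one_closed by metis
  have "finprod G (restrict y I) I = finprod G y I"
    using A(3) y by (intro finprod_cong') auto
  also have "\<dots> = finprod G (\<lambda>i\<in>I. \<one>) I"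
    unfolding 1 by (rule finprod_one_eqI[symmetric]) simp
  finally have "restrict y I = (\<lambda>i\<in>I. \<one>)"
    using inj_onD[OF inj] y one unfolding sg by simp
  then show ?thesis using \<open>i \<in> I\<close> by (metis restrict_apply')
qed

lemma (in comm_group) internal_direct_sum_surj:
  assumes ids: "internal_direct_sum G I A" and "finite I"
    and A: "\<And>i. i \<in> I \<Longrightarrow> group (A i)" and "c \<in> carrier G"
  shows "\<exists>y\<in>Pi\<^sub>E I (\<lambda>i. carrier (A i)). c = finprod G y I"
proof -
  have "carrier (sum_group I A) = Pi\<^sub>E I (\<lambda>i. carrier (A i))"
    using A(1) \<open>finite I\<close> by (simp add: carrier_sum_group)
  then have "carrier G = (\<lambda>x. finprod G x I) ` Pi\<^sub>E I (\<lambda>i. carrier (A i))"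
    using ids by (simp add: internal_direct_sum_def iso_def bij_betw_def)
  with \<open>c \<in> carrier G\<close> show ?thesis by auto
qed

text \<open>Independence speaks of the whole index set, so a relation over \<open>J\<close> is
  extended by factors \<open>\<one>\<close> outside \<open>J\<close>. The intended \<open>J\<close>
  is one row of the grid. Powers, and not exponents, are concluded to be trivial, since an
  \<open>x i\<close> may have finite order.\<close>

lemma (in comm_group) independent_family_trivial:
  fixes a :: "'i \<Rightarrow> int"
  assumes ind: "independent_family G I x" and "finite I" "J \<subseteq> I"
    and 1: "finprod G (\<lambda>i. x i [^] a i) J = \<one>" and "i \<in> J"
  shows "x i [^] a i = \<one>"
proof -
  let ?D = "subgroup_generated G (x ` I)"
  interpret D: comm_group ?D
    using abelian_subgroup_generated comm_group_axioms by blast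
  have x: "\<And>i. i \<in> I \<Longrightarrow> x i \<in> carrier G"
    and ids: "internal_direct_sum ?D I (\<lambda>i. subgroup_generated G {x i})"
    using ind by (auto simp: independent_family_def)
  define y where "y = (\<lambda>i. if i \<in> J then x i [^] a i else \<one>)"
  have sub: "carrier (subgroup_generated G {x i}) \<subseteq> carrier ?D" if "i \<in> I" for i
    unfolding carrier_subgroup_generated using that by (intro mono_generate) auto
  have y: "y i \<in> carrier (subgroup_generated G {x i})" if "i \<in> I" for i
    unfolding y_def carrier_subgroup_generated_by_singleton[OF x[OF that]]
    by (auto intro: range_eqI[of _ _ "0::int"])
  have "finprod ?D y I = finprod G y I"
    using y sub by (intro finprod_subgroup_generated) blast
  also have "\<dots> = finprod G (\<lambda>i. x i [^] a i) J"
    using x \<open>finite I\<close> \<open>J \<subseteq> I\<close> by (intro finprod_mono_neutral_cong_right) (auto simp: y_def)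
  finally have "finprod ?D y I = \<one>\<^bsub>?D\<^esub>" using 1 by simp
  from D.internal_direct_sum_trivial[OF ids \<open>finite I\<close> _ _ sub y this, of i]
  have "y i = \<one>" using \<open>i \<in> J\<close> \<open>J \<subseteq> I\<close> by auto
  then show ?thesis using \<open>i \<in> J\<close> by (simp add: y_def)
qed

text \<open>The relations of one row are the integer multiples of \<open>s\<close>. Subtracting
  \<open>d 0 div s 0\<close> copies of \<open>s\<close> leaves a remainder as exponent of
  \<open>x 0\<close>. The relation puts this power into the subgroup of the other
  \<open>x j\<close>, so the remainder is 0 by minimality, and \<open>free\<close> removes the other
  exponents.\<close>

lemma (in comm_group) single_row_relations:
  fixes x :: "nat \<Rightarrow> 'a" and s :: "nat \<Rightarrow> nat" and d :: "nat \<Rightarrow> int"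
  assumes x: "\<And>j. j \<le> t \<Longrightarrow> x j \<in> carrier G"
    and free: "\<And>d j. finprod G (\<lambda>j. x j [^] (d j::int)) {1..t} = \<one> \<Longrightarrow> j \<in> {1..t} \<Longrightarrow> d j = 0"
    and "s 0 > 0"
    and minimal: "\<And>m. 0 < m \<Longrightarrow> m < s 0 \<Longrightarrow> x 0 [^] m \<notin> generate G (x ` {1..t})"
    and rel: "inv (x 0 [^] s 0) = finprod G (\<lambda>j. x j [^] s j) {1..t}"
  shows "finprod G (\<lambda>j. x j [^] d j) {0..t} = \<one> \<longleftrightarrow> (\<exists>c. \<forall>j\<le>t. d j = c * int (s j))"
proof -
  have x': "x \<in> {0..t} \<rightarrow> carrier G" "x \<in> {1..t} \<rightarrow> carrier G" "x 0 \<in> carrier G" using x by auto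
  let ?D = "generate G (x ` {1..t})"
  interpret D: subgroup ?D G using x by (intro generate_is_subgroup) auto
  have split: "finprod G (\<lambda>j. x j [^] d j) {0..t} = x 0 [^] d 0 \<otimes> finprod G (\<lambda>j. x j [^] d j) {1..t}"
    for d :: "nat \<Rightarrow> int"
    using x by (simp add: atLeastAtMost_insertL[symmetric, of 0 t] Pi_iff del: One_nat_def)
      (simp add: Pi_iff)
  have gen: "finprod G (\<lambda>j. x j [^] d j) A \<in> ?D" if "A \<subseteq> {1..t}" for d :: "nat \<Rightarrow> int" and A
  proof -
    have "x j [^] d j \<in> ?D" if "j \<in> {1..t}" for j
      using that D.subgroup_axioms by (intro subgroup_int_pow_closed generate.incl) auto
    moreover have "finite A" using that finite_subset by blast
    ultimately show ?thesis using that x D.subset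
      by (induction A rule: infinite_finite_induct) (auto simp: Pi_iff subset_iff intro: generate.one generate.eng)
  qed
  have s1: "finprod G (\<lambda>j. x j [^] int (s j)) {0..t} = \<one>"
  proof -
    have "finprod G (\<lambda>j. x j [^] int (s j)) {1..t} = inv (x 0 [^] s 0)"
      unfolding rel by (simp add: int_pow_int)
    then show ?thesis unfolding split using x' by (simp add: int_pow_int)
  qed
  have scale: "finprod G (\<lambda>j. x j [^] (int (s j) * c)) {0..t} = \<one>" for c
    using x' by (subst finprod_int_pow_mult) (auto simp: s1)
  show ?thesis
  proof
    assume "\<exists>c. \<forall>j\<le>t. d j = c * int (s j)"
    then obtain c where c: "\<And>j. j \<le> t \<Longrightarrow> d j = c * int (s j)" by blast
    have "finprod G (\<lambda>j. x j [^] d j) {0..t} = finprod G (\<lambda>j. x j [^] (int (s j) * c)) {0..t}"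
      using c x by (intro finprod_cong') (auto simp: mult.commute)
    then show "finprod G (\<lambda>j. x j [^] d j) {0..t} = \<one>" using scale by simp
  next
    assume 1: "finprod G (\<lambda>j. x j [^] d j) {0..t} = \<one>"
    define c where "c = d 0 div int (s 0)"
    define d' where "d' j = d j + int (s j) * (- c)" for j
    have one': "finprod G (\<lambda>j. x j [^] d' j) {0..t} = \<one>"
      unfolding d'_def using x' scale[of "- c"] by (subst finprod_int_pow_add) (auto simp: 1)
    have d'0: "d' 0 = d 0 mod int (s 0)"
      unfolding d'_def c_def by (simp add: minus_mult_div_eq_mod)
    then have "0 \<le> d' 0" "d' 0 < int (s 0)" using \<open>s 0 > 0\<close> by auto
    have "x 0 [^] d' 0 = inv (finprod G (\<lambda>j. x j [^] d' j) {1..t})"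
      using one' x' unfolding split by (intro inv_equality[symmetric]) (auto intro!: finprod_closed)
    then have "x 0 [^] d' 0 \<in> ?D" using D.m_inv_closed[OF gen[OF order_refl, of d']] by simp
    moreover have "x 0 [^] d' 0 = x 0 [^] nat (d' 0)"
      using \<open>0 \<le> d' 0\<close> by (metis int_pow_int nat_0_le)
    ultimately have "x 0 [^] nat (d' 0) \<in> ?D" by (rule subst[rotated])
    then have "\<not> 0 < nat (d' 0)" using minimal[of "nat (d' 0)"] \<open>d' 0 < int (s 0)\<close> by linarith
    then have "d' 0 = 0" using \<open>0 \<le> d' 0\<close> by simp
    then have "finprod G (\<lambda>j. x j [^] d' j) {1..t} = \<one>"
      using one' x' unfolding split by (auto simp: finprod_closed Pi_iff)
    then have "d' j = 0" if "j \<le> t" for j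
      using free[of d' j] \<open>d' 0 = 0\<close> that by (cases "j = 0") auto
    then have "\<forall>j\<le>t. d j = c * int (s j)" unfolding d'_def by (simp add: mult.commute)
    then show "\<exists>c. \<forall>j\<le>t. d j = c * int (s j)" by blast
  qed
qed

text \<open>Writing \<open>e 0 j\<close> as the inverse of the product of its column spreads the
  exponent \<open>- m 0 j\<close> over the rows 1 to \<open>k\<close>. The result is a product of
  elements \<open>row i\<close>, one from each summand of the direct sum, so it is trivial only if
  every \<open>row i\<close> is.\<close>

lemma (in comm_group) grid_relations:
  fixes e :: "nat \<Rightarrow> nat \<Rightarrow> 'a" and s :: "nat \<Rightarrow> nat" and m :: "nat \<Rightarrow> nat \<Rightarrow> int"
  assumes e: "\<And>i j. 1 \<le> i \<Longrightarrow> i \<le> k \<Longrightarrow> j \<le> t \<Longrightarrow> e i j \<in> carrier G"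
    and e0: "\<And>j. j \<le> t \<Longrightarrow> e 0 j = inv (finprod G (\<lambda>i. e i j) {1..k})"
    and ind: "independent_family G ({1..k} \<times> {1..t}) (\<lambda>(i, j). e i j)"
    and inf: "\<And>i j. i \<in> {1..k} \<Longrightarrow> j \<in> {1..t} \<Longrightarrow> ord (e i j) = 0"
    and "s 0 > 0"
    and minimal: "\<And>i m. i \<in> {1..k} \<Longrightarrow> 0 < m \<Longrightarrow> m < s 0 \<Longrightarrow> e i 0 [^] m \<notin> generate G (e i ` {1..t})"
    and rel: "\<And>i. i \<in> {1..k} \<Longrightarrow> inv (e i 0 [^] s 0) = finprod G (\<lambda>j. e i j [^] s j) {1..t}"
    and ids: "internal_direct_sum G {1..k} (\<lambda>i. subgroup_generated G (e i ` {0..t}))"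
  shows "finprod G (\<lambda>i. finprod G (\<lambda>j. e i j [^] m i j) {0..t}) {0..k} = \<one> \<longleftrightarrow>
    (\<exists>c. \<forall>i\<in>{1..k}. \<forall>j\<le>t. m i j - m 0 j = c i * int (s j))"
proof -
  define row where "row i = finprod G (\<lambda>j. e i j [^] (m i j - m 0 j)) {0..t}" for i
  have e0c: "e 0 j \<in> carrier G" if "j \<le> t" for j
    unfolding e0[OF that] using that e by (intro inv_closed finprod_closed) auto
  have ec: "e i j \<in> carrier G" if "i \<le> k" "j \<le> t" for i j
    using that e e0c by (cases "i = 0") auto
  have row: "row i = \<one> \<longleftrightarrow> (\<exists>c. \<forall>j\<le>t. m i j - m 0 j = c * int (s j))" if i: "i \<in> {1..k}" for i
    unfolding row_def
  proof (rule single_row_relations)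
    fix d :: "nat \<Rightarrow> int" and j
    assume 1: "finprod G (\<lambda>j. e i j [^] d j) {1..t} = \<one>" and j: "j \<in> {1..t}"
    \<comment> \<open>Independence is indexed by pairs, so row \<open>i\<close> is read as the image
      of \<open>{1..t}\<close> under \<open>Pair i\<close>. Infinite order then turns a trivial
      power into a zero exponent.\<close>
    have "finprod G (\<lambda>p. (case p of (i, j) \<Rightarrow> e i j) [^] d (snd p)) (Pair i ` {1..t}) =
        finprod G (\<lambda>j. e i j [^] d j) {1..t}"
      using i ec by (subst finprod_reindex) (auto simp: inj_on_def)
    with 1 have "(case (i, j) of (i, j) \<Rightarrow> e i j) [^] d (snd (i, j)) = \<one>"
      using i j by (intro independent_family_trivial[OF ind, of "Pair i ` {1..t}"]) auto
    then show "d j = 0" using int_pow_eq_id[of "e i j" "d j"] inf[OF i j] ec i j by simp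
  next
    show "e i j \<in> carrier G" if "j \<le> t" for j using ec i that by simp
    show "s 0 > 0" by fact
    show "e i 0 [^] m \<notin> generate G (e i ` {1..t})" if "0 < m" "m < s 0" for m
      using i that by (rule minimal)
    show "inv (e i 0 [^] s 0) = finprod G (\<lambda>j. e i j [^] s j) {1..t}" using i by (rule rel)
  qed
  \<comment> \<open>The direct sum only compares families with members in its summands, so products
    formed in \<open>G\<close> have to be recognized inside the subgroup of row
    \<open>i\<close>.\<close>
  have rowc: "row i \<in> carrier (subgroup_generated G (e i ` {0..t}))" if i: "i \<in> {1..k}" for i
  proof -
    interpret D: comm_group "subgroup_generated G (e i ` {0..t})"
      using abelian_subgroup_generated comm_group_axioms by blast
    have mem: "e i j \<in> carrier (subgroup_generated G (e i ` {0..t}))" if "j \<in> {0..t}" for j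
      unfolding carrier_subgroup_generated using i ec that by (intro generate.incl) auto
    have "e i j [^] n \<in> carrier (subgroup_generated G (e i ` {0..t}))" if "j \<in> {0..t}" for j and n :: int
      using D.int_pow_closed[OF mem[OF that]] int_pow_subgroup_generated[OF mem[OF that]] by simp
    then show ?thesis
      unfolding row_def
      by (subst finprod_subgroup_generated[symmetric]) (auto intro!: D.finprod_closed)
  qed
  have "finprod G (\<lambda>i. finprod G (\<lambda>j. e i j [^] m i j) {0..t}) {0..k} =
      finprod G (\<lambda>j. e 0 j [^] m 0 j) {0..t} \<otimes> finprod G (\<lambda>i. finprod G (\<lambda>j. e i j [^] m i j) {0..t}) {1..k}"
  proof -
    have "{0..k} = insert 0 {1..k}" by auto
    then show ?thesis using ec by (simp del: One_nat_def)
  qed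
  also have "finprod G (\<lambda>j. e 0 j [^] m 0 j) {0..t} =
      finprod G (\<lambda>j. finprod G (\<lambda>i. e i j [^] (- m 0 j)) {1..k}) {0..t}"
  proof (rule finprod_cong')
    fix j assume j: "j \<in> {0..t}"
    have "e 0 j [^] m 0 j = finprod G (\<lambda>i. e i j) {1..k} [^] (- m 0 j)"
      using j ec e0[of j] by (simp add: int_pow_neg int_pow_inv finprod_closed Pi_iff)
    also have "\<dots> = finprod G (\<lambda>i. e i j [^] (- m 0 j)) {1..k}"
      using j ec by (intro finprod_int_pow) auto
    finally show "e 0 j [^] m 0 j = finprod G (\<lambda>i. e i j [^] (- m 0 j)) {1..k}" .
  qed (use ec in \<open>auto intro!: finprod_closed\<close>)
  also have "\<dots> = finprod G (\<lambda>i. finprod G (\<lambda>j. e i j [^] (- m 0 j)) {0..t}) {1..k}"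
    using ec by (intro finprod_swap) auto
  also have "\<dots> \<otimes> finprod G (\<lambda>i. finprod G (\<lambda>j. e i j [^] m i j) {0..t}) {1..k} =
      finprod G (\<lambda>i. finprod G (\<lambda>j. e i j [^] (- m 0 j)) {0..t} \<otimes> finprod G (\<lambda>j. e i j [^] m i j) {0..t}) {1..k}"
    using ec by (intro finprod_multf[symmetric]) (auto intro!: finprod_closed)
  also have "\<dots> = finprod G row {1..k}"
  proof (rule finprod_cong')
    fix i assume i: "i \<in> {1..k}"
    show "finprod G (\<lambda>j. e i j [^] (- m 0 j)) {0..t} \<otimes> finprod G (\<lambda>j. e i j [^] m i j) {0..t} = row i"
      unfolding row_def using i ec by (subst finprod_int_pow_add[symmetric]) (auto simp: add.commute)
  qed (use ec in \<open>auto simp: row_def intro!: finprod_closed\<close>)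
  also have "finprod G row {1..k} = \<one> \<longleftrightarrow> (\<forall>i\<in>{1..k}. row i = \<one>)"
  proof
    assume "finprod G row {1..k} = \<one>"
    then show "\<forall>i\<in>{1..k}. row i = \<one>"
      using carrier_subgroup_generated_subset rowc
      by (intro ballI internal_direct_sum_trivial[OF ids, of row]) auto
  qed (auto intro: finprod_one_eqI)
  also have "\<dots> \<longleftrightarrow> (\<forall>i\<in>{1..k}. \<exists>c. \<forall>j\<le>t. m i j - m 0 j = c * int (s j))"
    using row by simp
  also have "\<dots> \<longleftrightarrow> (\<exists>c. \<forall>i\<in>{1..k}. \<forall>j\<le>t. m i j - m 0 j = c i * int (s j))"
    by (rule bchoice_iff)
  finally show ?thesis .
qed

section \<open>Distinctness of the classes\<close>

lemma (in comm_group) finprod_grid_add: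
  fixes m m' :: "nat \<Rightarrow> nat \<Rightarrow> int"
  assumes "\<And>i j. i \<in> I \<Longrightarrow> j \<in> J \<Longrightarrow> e i j \<in> carrier G"
  shows "finprod G (\<lambda>i. finprod G (\<lambda>j. e i j [^] (m i j + m' i j)) J) I =
    finprod G (\<lambda>i. finprod G (\<lambda>j. e i j [^] m i j) J) I \<otimes> finprod G (\<lambda>i. finprod G (\<lambda>j. e i j [^] m' i j) J) I"
proof -
  have "finprod G (\<lambda>i. finprod G (\<lambda>j. e i j [^] (m i j + m' i j)) J) I =
      finprod G (\<lambda>i. finprod G (\<lambda>j. e i j [^] m i j) J \<otimes> finprod G (\<lambda>j. e i j [^] m' i j) J) I"
    using assms by (intro finprod_cong' finprod_int_pow_add) (auto intro!: finprod_closed)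
  also have "\<dots> = finprod G (\<lambda>i. finprod G (\<lambda>j. e i j [^] m i j) J) I \<otimes> finprod G (\<lambda>i. finprod G (\<lambda>j. e i j [^] m' i j) J) I"
    using assms by (intro finprod_multf) (auto intro!: finprod_closed)
  finally show ?thesis .
qed

text \<open>Together with \<open>finprod_grid_add\<close> this evaluates the relation that would
  hold between two equal classes.\<close>

lemma (in comm_group) finprod_grid_single:
  assumes e: "\<And>i j. i \<in> I \<Longrightarrow> j \<in> J \<Longrightarrow> e i j \<in> carrier G"
    and "finite I" "finite J" "p \<in> I" "q \<in> J"
  shows "finprod G (\<lambda>i. finprod G (\<lambda>j. e i j [^] (if i = p \<and> j = q then c else 0 :: int)) J) I = e p q [^] c"
proof -
  have "finprod G (\<lambda>j. e i j [^] (if i = p \<and> j = q then c else 0)) J = (if p = i then e i q [^] c else \<one>)"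
    if i: "i \<in> I" for i
  proof -
    have "finprod G (\<lambda>j. e i j [^] (if i = p \<and> j = q then c else 0)) J =
        finprod G (\<lambda>j. if q = j then (if p = i then e i j [^] c else \<one>) else \<one>) J"
      using e i by (intro finprod_cong') auto
    also have "\<dots> = (if p = i then e i q [^] c else \<one>)"
      using e i \<open>finite J\<close> \<open>q \<in> J\<close> by (intro finprod_singleton) auto
    finally show ?thesis .
  qed
  then have "finprod G (\<lambda>i. finprod G (\<lambda>j. e i j [^] (if i = p \<and> j = q then c else 0)) J) I =
      finprod G (\<lambda>i. if p = i then e i q [^] c else \<one>) I"
    using e \<open>q \<in> J\<close> by (intro finprod_cong') auto
  also have "\<dots> = e p q [^] c"
    using e assms by (intro finprod_singleton) auto
  finally show ?thesis .
qed

text \<open>Applied to the relation \<open>e i j - e i' j' = 0\<close>. Equality of classes in different rows would force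
  \<open>\<Sum> s j = 2\<close>, and then \<open>k \<ge> 2\<close> provides a third row, which is incompatible with it.\<close>

lemma unit_matrix_difference_not_proportional:
  fixes s :: "nat \<Rightarrow> nat" and a c :: "nat \<Rightarrow> int"
  assumes "k \<ge> 1" and s: "\<And>j. j \<le> t \<Longrightarrow> s j \<ge> 1" and sum: "(\<Sum>j=0..t. s j) \<ge> 2" "k + 1 \<noteq> (\<Sum>j=0..t. s j)"
    and ij: "i \<le> k" "i' \<le> k" "j \<le> t" "j' \<le> t"
    and m: "\<And>p q. p \<le> k \<Longrightarrow> q \<le> t \<Longrightarrow>
      (if p = i \<and> q = j then 1 else 0) + (if p = i' \<and> q = j' then -1 else 0) = a q + c p * int (s q)"
  shows "i = i' \<and> j = j'"
proof (cases "i = i'")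
  case True
  obtain p where p: "p \<le> k" "p \<noteq> i" using \<open>k \<ge> 1\<close> by (cases "i = 0") auto
  have *: "(if q = j then 1 else 0) + (if q = j' then -1 else 0) = (c i - c p) * int (s q)" if "q \<le> t" for q
    using m[OF p(1) that] m[OF ij(1) that] p(2) True by (simp add: algebra_simps)
  have "j = j'"
  proof (rule ccontr)
    assume "j \<noteq> j'"
    \<comment> \<open>One and the same integer would have a positive and a negative product with the
      positive numbers \<open>s j\<close> and \<open>s j'\<close>.\<close>
    then have 1: "(c i - c p) * int (s j) = 1" and 2: "(c i - c p) * int (s j') = -1"
      using *[OF ij(3)] *[OF ij(4)] by auto
    from 1 have "c i - c p > 0" by (metis of_nat_0_le_iff zero_less_mult_pos2 zero_less_one mult_zero_right order_le_less)
    then have "(c i - c p) * int (s j') \<ge> 0" by simp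
    with 2 show False by simp
  qed
  with True show ?thesis by simp
next
  case False
  let ?s = "\<Sum>q=0..t. int (s q)"
  have s2: "?s \<ge> 2" using sum(1) by (metis of_nat_le_iff of_nat_numeral of_nat_sum)
  have delta: "(\<Sum>q=0..t. if q = j then 1 else 0) = (1::int)" if "j \<le> t" for j using that by simp
  have "(if q = j then 1 else 0) + (if q = j' then 1 else 0) = (c i - c i') * int (s q)" if "q \<le> t" for q
  proof -
    have 1: "(if q = j then 1 else 0) = a q + c i * int (s q)" using m[OF ij(1) that] False by simp
    have 2: "(if q = j' then -1 else 0) = a q + c i' * int (s q)" using m[OF ij(2) that] False by simp
    have "(if q = j then 1 else 0) + (if q = j' then 1 else 0) = (if q = j then 1 else 0) - (if q = j' then -1 else (0::int))"
      by simp
    also have "\<dots> = (c i - c i') * int (s q)" unfolding 1 2 by (simp add: algebra_simps)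
    finally show ?thesis .
  qed
  \<comment> \<open>Summing over all columns turns the difference of the rows \<open>i\<close> and
    \<open>i'\<close> into a factorization of 2, in which \<open>?s\<close> is already at least
    2.\<close>
  then have "(\<Sum>q=0..t. (if q = j then 1 else 0) + (if q = j' then 1 else 0)) = (\<Sum>q=0..t. (c i - c i') * int (s q))"
    by (intro sum.cong) auto
  then have 2: "(c i - c i') * ?s = 2"
    using delta[OF ij(3)] delta[OF ij(4)] by (simp add: sum.distrib sum_distrib_left)
  have "c i - c i' > 0" using 2 s2 by (metis zero_less_mult_pos2 zero_less_numeral order_less_le_trans)
  then have "?s \<le> (c i - c i') * ?s" using s2 by (simp add: mult_le_cancel_right1)
  with 2 s2 have s_eq: "?s = 2" by simp
  have "(\<Sum>q=0..t. s q) = 2" using s_eq by (metis of_nat_eq_iff of_nat_numeral of_nat_sum)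
  with sum(2) \<open>k \<ge> 1\<close> have "k \<ge> 2" by simp
  have "\<not> {0..k} \<subseteq> {i, i'}"
  proof
    assume "{0..k} \<subseteq> {i, i'}"
    then have "card {0..k} \<le> card {i, i'}" by (intro card_mono) auto
    also have "\<dots> \<le> 2" by (simp add: card_insert_if)
    finally show False using \<open>k \<ge> 2\<close> by simp
  qed
  then obtain p where "p \<in> {0..k}" "p \<notin> {i, i'}" by blast
  then have p: "p \<le> k" "p \<noteq> i" "p \<noteq> i'" by auto
  \<comment> \<open>The left-hand side of \<open>m\<close> vanishes on the third row
    \<open>p\<close>. Its difference to row \<open>i\<close>, summed over the columns, makes 1 a
    multiple of \<open>?s\<close>, which is 2.\<close>
  have "(if q = j then 1 else 0) = (c i - c p) * int (s q)" if "q \<le> t" for q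
    using m[OF ij(1) that] m[OF p(1) that] p False by (simp add: algebra_simps)
  then have "(\<Sum>q=0..t. if q = j then 1 else 0) = (\<Sum>q=0..t. (c i - c p) * int (s q))"
    by (intro sum.cong) auto
  then have "(c i - c p) * 2 = 1"
    using delta[OF ij(3)] s_eq by (simp flip: sum_distrib_left)
  then show ?thesis by presburger
qed

section \<open>Products of sequences over the grid\<close>

lemma (in comm_monoid) mset_prod_sum:
  assumes "finite A" "\<And>i. i \<in> A \<Longrightarrow> set_mset (f i) \<subseteq> carrier G"
  shows "mset_prod G (\<Sum>i\<in>A. f i) = finprod G (\<lambda>i. mset_prod G (f i)) A"
  using assms
proof (induction A)
  case (insert a A)
  have "set_mset (\<Sum>i\<in>A. f i) \<subseteq> carrier G"
    using insert by (fastforce simp: set_mset_sum)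
  then show ?case using insert by (simp add: mset_prod_union mset_prod_closed Pi_iff)
qed simp

lemma (in comm_monoid) mset_prod_replicate:
  "x \<in> carrier G \<Longrightarrow> mset_prod G (replicate_mset n x) = x [^] n"
  by (cases "n = 0") (simp_all add: mset_prod_def)

text \<open>Distinctness of the entries is essential: a class standing at two positions would have
  its multiplicity counted twice.\<close>

lemma (in comm_group) mset_prod_grid:
  fixes e :: "nat \<Rightarrow> nat \<Rightarrow> 'a"
  assumes "\<And>i j. i \<le> k \<Longrightarrow> j \<le> t \<Longrightarrow> e i j \<in> carrier G"
    and inj: "\<And>i i' j j'. \<lbrakk>i \<le> k; i' \<le> k; j \<le> t; j' \<le> t; e i j = e i' j'\<rbrakk> \<Longrightarrow> i = i' \<and> j = j'"
    and S: "set_mset S \<subseteq> {e i j | i j. i \<le> k \<and> j \<le> t}"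
  shows "mset_prod G S = finprod G (\<lambda>i. finprod G (\<lambda>j. e i j [^] int (count S (e i j))) {0..t}) {0..k}"
proof -
  let ?R = "\<lambda>i j. replicate_mset (count S (e i j)) (e i j)"
  have "count S x = count (\<Sum>i=0..k. \<Sum>j=0..t. ?R i j) x" for x
  proof (cases "x \<in> {e i j | i j. i \<le> k \<and> j \<le> t}")
    case True
    then obtain p q where x: "x = e p q" "p \<le> k" "q \<le> t" by auto
    have "count (\<Sum>i=0..k. \<Sum>j=0..t. ?R i j) x = (\<Sum>i=0..k. \<Sum>j=0..t. if j = q then if i = p then count S x else 0 else 0)"
    proof -
      have "count (?R i j) x = (if j = q then if i = p then count S x else 0 else 0)"
        if "i \<in> {0..k}" "j \<in> {0..t}" for i j
      proof (cases "i = p \<and> j = q")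
        case False
        then have "e i j \<noteq> x" using inj[of i p j q] that x by auto
        with False show ?thesis by auto
      qed (simp add: x(1))
      then show ?thesis unfolding count_sum by (intro sum.cong refl)
    qed
    also have "\<dots> = (\<Sum>i=0..k. if i = p then count S x else 0)"
      using x(3) by (intro sum.cong refl) simp
    also have "\<dots> = count S x" using x(2) by simp
    finally show ?thesis by (rule sym)
  next
    case False
    then have "x \<notin># S" using S by blast
    then have "count S x = 0" by (simp add: not_in_iff)
    moreover have "count (\<Sum>i=0..k. \<Sum>j=0..t. ?R i j) x = 0"
    proof -
      have "x \<noteq> e i j" if "i \<le> k" "j \<le> t" for i j using False that by blast
      then show ?thesis unfolding count_sum by (intro sum.neutral ballI) simp
    qed
    ultimately show ?thesis by simp
  qed
  then have "S = (\<Sum>i=0..k. \<Sum>j=0..t. ?R i j)" by (rule multiset_eqI)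
  then have "mset_prod G S = mset_prod G (\<Sum>i=0..k. \<Sum>j=0..t. ?R i j)" by (rule arg_cong)
  also have "\<dots> = finprod G (\<lambda>i. mset_prod G (\<Sum>j=0..t. ?R i j)) {0..k}"
    using assms(1) by (intro mset_prod_sum) (auto simp: set_mset_sum split: if_splits)
  also have "\<dots> = finprod G (\<lambda>i. finprod G (\<lambda>j. e i j [^] int (count S (e i j))) {0..t}) {0..k}"
  proof (intro finprod_cong' refl)
    fix i assume i: "i \<in> {0..k}"
    have "mset_prod G (\<Sum>j=0..t. ?R i j) = finprod G (\<lambda>j. mset_prod G (?R i j)) {0..t}"
      using i assms(1) by (intro mset_prod_sum) (auto split: if_splits)
    also have "\<dots> = finprod G (\<lambda>j. e i j [^] int (count S (e i j))) {0..t}"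
      using i assms(1) by (intro finprod_cong') (auto simp: mset_prod_replicate int_pow_int)
    finally show "mset_prod G (\<Sum>j=0..t. ?R i j) = finprod G (\<lambda>j. e i j [^] int (count S (e i j))) {0..t}" .
  qed (use assms(1) in \<open>auto intro!: finprod_closed\<close>)
  finally show ?thesis .
qed

lemma (in comm_group) subgroup_finprod_closed:
  assumes "subgroup K G" "\<And>i. i \<in> A \<Longrightarrow> f i \<in> K"
  shows "finprod G f A \<in> K"
proof -
  interpret K: subgroup K G by fact
  show ?thesis using assms(2)
    by (induction A rule: infinite_finite_induct) (auto simp: Pi_iff)
qed

section \<open>Sets of lengths\<close>

lemma comm_group_imp_cancel:
  assumes "comm_group G"
  shows "comm_monoid_cancel G"
proof -
  interpret comm_group G by fact
  show ?thesis by (rule comm_monoid_cancelI) (simp_all add: comm_monoid_axioms)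
qed

lemma iso_mem_atom_prods:
  assumes "comm_monoid_cancel G" "comm_monoid_cancel K" "h \<in> iso G K" "a \<in> carrier G"
  shows "h a \<in> atom_prods K n \<longleftrightarrow> a \<in> atom_prods G n"
proof -
  interpret G: comm_monoid_cancel G by fact
  have "inj_on h (carrier G)" using assms(3) by (auto simp: iso_def bij_betw_def)
  then show ?thesis
    unfolding iso_atom_prods[OF assms(1-3)] using assms(4) G.atom_prods_closed
    by (auto dest: inj_onD)
qed

text \<open>A sum of two members depends on \<open>\<nu>1 + \<nu>2\<close> only, and this runs
  through all of \<open>{0..x1 + x2}\<close>.\<close>

lemma arithmetical_sumset:
  fixes a b :: nat
  shows "{l1 + l2 | l1 l2. l1 \<in> (\<lambda>\<nu>. y1 + \<nu> * a + (x1 - \<nu>) * b) ` {0..x1} \<and>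
       l2 \<in> (\<lambda>\<nu>. y2 + \<nu> * a + (x2 - \<nu>) * b) ` {0..x2}} =
     (\<lambda>\<nu>. (y1 + y2) + \<nu> * a + (x1 + x2 - \<nu>) * b) ` {0..x1 + x2}" (is "?L = ?R")
proof (intro equalityI subsetI)
  fix l assume "l \<in> ?L"
  then obtain \<nu>1 \<nu>2 where \<nu>: "\<nu>1 \<le> x1" "\<nu>2 \<le> x2"
    "l = (y1 + \<nu>1 * a + (x1 - \<nu>1) * b) + (y2 + \<nu>2 * a + (x2 - \<nu>2) * b)" by auto
  \<comment> \<open>Replacing \<open>x1\<close> and \<open>x2\<close> by sums removes the truncated
    subtractions.\<close>
  then obtain d1 d2 where "x1 = \<nu>1 + d1" "x2 = \<nu>2 + d2" using le_Suc_ex by metis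
  with \<nu> show "l \<in> ?R" by (intro image_eqI[of _ _ "\<nu>1 + \<nu>2"]) (simp_all add: algebra_simps)
next
  fix l assume "l \<in> ?R"
  then obtain \<nu> where \<nu>: "\<nu> \<le> x1 + x2" "l = (y1 + y2) + \<nu> * a + (x1 + x2 - \<nu>) * b" by auto
  \<comment> \<open>Greedy splitting: as much of \<open>\<nu>\<close> as possible goes to the first
    set, and what is left is at most \<open>x2\<close>.\<close>
  define \<nu>1 where "\<nu>1 = min \<nu> x1"
  define \<nu>2 where "\<nu>2 = \<nu> - \<nu>1"
  have le: "\<nu>1 \<le> x1" "\<nu>2 \<le> x2" "\<nu> = \<nu>1 + \<nu>2" using \<nu>(1) by (auto simp: \<nu>1_def \<nu>2_def)
  then obtain d1 d2 where "x1 = \<nu>1 + d1" "x2 = \<nu>2 + d2" using le_Suc_ex by metis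
  then have "l = (y1 + \<nu>1 * a + (x1 - \<nu>1) * b) + (y2 + \<nu>2 * a + (x2 - \<nu>2) * b)"
    using \<nu>(2) le(3) by (simp add: algebra_simps)
  moreover have "y1 + \<nu>1 * a + (x1 - \<nu>1) * b \<in> (\<lambda>\<nu>. y1 + \<nu> * a + (x1 - \<nu>) * b) ` {0..x1}"
      "y2 + \<nu>2 * a + (x2 - \<nu>2) * b \<in> (\<lambda>\<nu>. y2 + \<nu> * a + (x2 - \<nu>) * b) ` {0..x2}"
    using le by auto
  ultimately show "l \<in> ?L" by blast
qed

text \<open>Through \<open>f\<close> an element is a triple of a unit, a multiset of primes and an
  element of \<open>H'\<close>. Lengths add over the coordinates, with 0 from the first and exactly
  \<open>size z\<close> from the second. All pairs \<open>z\<close>, \<open>b\<close> occur, as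
  there is always a unit to complete them.\<close>

lemma length_system_decomposition:
  assumes H: "comm_monoid_cancel H" and H': "comm_monoid_cancel H'" and B: "comm_monoid_cancel B"
    and f: "f \<in> iso (units_of H \<times>\<times> free_monoid P\<^sub>0 \<times>\<times> H') H" and h: "h \<in> iso H' B"
  shows "length_system H = {(+) (size z) ` length_set B b | z b. set_mset z \<subseteq> P\<^sub>0 \<and> b \<in> carrier B}"
proof -
  let ?K = "units_of H \<times>\<times> free_monoid P\<^sub>0 \<times>\<times> H'"
  interpret H: comm_monoid_cancel H by fact
  interpret B: comm_monoid_cancel B by fact
  have U: "comm_monoid_cancel (units_of H)" by (rule comm_group_imp_cancel[OF H.units_comm_group])
  have FH: "comm_monoid_cancel (free_monoid P\<^sub>0 \<times>\<times> H')" by (rule DirProd_cancel[OF free_monoid_cancel H'])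
  have K: "comm_monoid_cancel ?K" by (rule DirProd_cancel[OF U FH])
  have units: "Units (units_of H) = carrier (units_of H)" by (rule group.Units_eq[OF H.units_group])
  have hc: "h b \<in> carrier B" if "b \<in> carrier H'" for b
    using h that by (auto simp: iso_def hom_def)
  have len: "length_set H (f (u, z, b)) = (+) (size z) ` length_set B (h b)"
    if w: "u \<in> carrier (units_of H)" "set_mset z \<subseteq> P\<^sub>0" "b \<in> carrier H'" for u z b
  proof -
    have wK: "(u, z, b) \<in> carrier ?K" using w by simp
    have "f (u, z, b) \<in> carrier H" using f wK unfolding iso_def hom_def by blast
    then have "length_set H (f (u, z, b)) = {n. (u, z, b) \<in> atom_prods ?K n}"
      using iso_mem_atom_prods[OF K H f wK] by (simp add: H.length_set_eq)
    also have "\<dots> = {size z + m | m. b \<in> atom_prods H' m}"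
      using w(1,2) by (auto simp: DirProd_atom_prods_iff[OF U FH] DirProd_atom_prods_iff[OF free_monoid_cancel H']
          atom_prods_group[OF units] mem_atom_prods_free_monoid split: if_splits)
    also have "\<dots> = (+) (size z) ` length_set B (h b)"
      using iso_mem_atom_prods[OF H' B h w(3)] hc[OF w(3)] by (auto simp: B.length_set_eq)
    finally show ?thesis .
  qed
  have "carrier H = f ` carrier ?K" using f by (simp add: iso_def bij_betw_def)
  then have "length_system H = {length_set H (f (u, z, b)) | u z b. u \<in> carrier (units_of H) \<and> set_mset z \<subseteq> P\<^sub>0 \<and> b \<in> carrier H'}"
    unfolding length_system_def by auto
  also have "\<dots> = {(+) (size z) ` length_set B (h b) | u z b. u \<in> carrier (units_of H) \<and> set_mset z \<subseteq> P\<^sub>0 \<and> b \<in> carrier H'}"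
    using len by (metis (no_types, lifting))
  also have "\<dots> = {(+) (size z) ` length_set B (h b) | z b. set_mset z \<subseteq> P\<^sub>0 \<and> b \<in> carrier H'}"
    using H.Units_one_closed by (auto simp: units_of_carrier)
  also have "\<dots> = {(+) (size z) ` length_set B b | z b. set_mset z \<subseteq> P\<^sub>0 \<and> b \<in> carrier B}"
  proof -
    have "carrier B = h ` carrier H'" using h by (simp add: iso_def bij_betw_def)
    then show ?thesis by auto
  qed
  finally show ?thesis .
qed

text \<open>The two descriptions of the i-th summand, by \<open>insert (g i)\<close> and by the full
  row \<open>{0..t}\<close>, are known to agree for indices in range only.\<close>

lemma sum_group_cong:
  assumes "\<And>i. i \<in> I \<Longrightarrow> A i = B i"
  shows "sum_group I A = sum_group I B"
proof -
  have "product_group I A = product_group I B"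
    using assms by (simp add: product_group_def cong: PiE_cong restrict_cong)
  moreover have "{x \<in> \<Pi>\<^sub>E i\<in>I. carrier (A i). finite {i \<in> I. x i \<noteq> \<one>\<^bsub>A i\<^esub>}} =
      {x \<in> \<Pi>\<^sub>E i\<in>I. carrier (B i). finite {i \<in> I. x i \<noteq> \<one>\<^bsub>B i\<^esub>}}"
    using assms by (simp cong: PiE_cong conj_cong)
  ultimately show ?thesis by (simp add: sum_group_def)
qed

section \<open>From the class group data to the grid, and back to \<open>H\<close>\<close>

theorem corollary1p2:
  fixes H :: "'a monoid"
    and P :: "'p set" and \<phi> :: "'a set \<Rightarrow> 'p multiset"
    and P\<^sub>0 S :: "'a set"
    and P' :: "'q set" and \<phi>' :: "'a set \<Rightarrow> 'q multiset"
    and t k :: nat and s :: "nat \<Rightarrow> nat" and n :: nat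
    and g :: "nat \<Rightarrow> ('q multiset \<times> 'q multiset) set set"
    and e :: "nat \<Rightarrow> nat \<Rightarrow> ('q multiset \<times> 'q multiset) set set"
  defines "H' \<equiv> H\<lparr>carrier := S\<rparr>"
  defines "C \<equiv> class_group (red_monoid H') P' \<phi>'"
  defines "G' \<equiv> prime_divisor_class (red_monoid H') P' \<phi>' ` P'"
  defines "U \<equiv> \<lambda>i. \<Sum>j=0..t. replicate_mset (s j) (e i j)"
  defines "V \<equiv> \<lambda>j. \<Sum>i=0..k. {#e i j#}"
  defines "normal_form \<equiv> \<lambda>B (x, y, z).
           y \<in> {0..k} \<rightarrow>\<^sub>E UNIV \<and> z \<in> {0..t} \<rightarrow>\<^sub>E UNIV \<and>
           B = repeat_mset x (\<Sum>i=0..k. U i) + (\<Sum>i=0..k. repeat_mset (y i) (U i))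
                 + (\<Sum>j=0..t. repeat_mset (z j) (V j)) \<and>
           (\<exists>i\<in>{0..k}. y i = 0) \<and> (\<exists>j\<in>{0..t}. z j < s j)"
  assumes "krull_monoid H" and "length_factorial H" and "\<not> factorial_monoid H"
    and "divisor_theory (red_monoid H) P \<phi>"
    \<comment> \<open>\<open>H\<close> is the internal direct product of its group of units, a free abelian monoid on
        representatives of the primes, and the submonoid \<open>H'\<close>\<close>
    and "P\<^sub>0 \<subseteq> {p \<in> carrier H. Divisibility.prime H p}"
    and "\<forall>q\<in>carrier H. Divisibility.prime H q \<longrightarrow> (\<exists>!p. p \<in> P\<^sub>0 \<and> p \<sim>\<^bsub>H\<^esub> q)"
    and "submonoid S H"
    and "(\<lambda>(u, z, a). u \<otimes>\<^bsub>H\<^esub> (mset_prod H z \<otimes>\<^bsub>H\<^esub> a))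
           \<in> iso (units_of H \<times>\<times> free_monoid P\<^sub>0 \<times>\<times> H') H"
    and "reduced H'" and "krull_monoid H'"
    and "\<forall>p\<in>carrier H'. \<not> Divisibility.prime H' p"
    and "divisor_theory (red_monoid H') P' \<phi>'"
    and "C \<cong> class_group (red_monoid H) P \<phi>"
    and "inj_on (prime_divisor_class (red_monoid H') P' \<phi>') P'"
    and "H' \<cong> zero_sum_monoid C G'"
    and "k \<ge> 1" and "\<forall>j\<in>{0..t}. s j \<ge> 1"
    and "k + 1 \<noteq> (\<Sum>j=0..t. s j)" and "(\<Sum>j=0..t. s j) \<ge> 2"
    and "independent_family C ({1..k} \<times> {1..t}) (\<lambda>(i, j). e i j)"
    and "\<forall>i\<in>{1..k}. \<forall>j\<in>{1..t}. group.ord C (e i j) = 0"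
    and "independent_family C {1..k} g"
    and "\<forall>i\<in>{1..k}. if t > 0 then group.ord C (g i) = 0 else group.ord C (g i) > 0"
    and "\<forall>i\<in>{1..k}. g i [^]\<^bsub>C\<^esub> s 0 \<in> generate C (e i ` {1..t})"
    and "\<forall>i\<in>{1..k}. \<forall>m. 0 < m \<and> m < s 0 \<longrightarrow> g i [^]\<^bsub>C\<^esub> m \<notin> generate C (e i ` {1..t})"
    and "\<forall>i\<in>{1..k}. inv\<^bsub>C\<^esub> (g i [^]\<^bsub>C\<^esub> s 0) = finprod C (\<lambda>j. e i j [^]\<^bsub>C\<^esub> s j) {1..t}"
    and "\<forall>j\<in>{1..t}. e 0 j = inv\<^bsub>C\<^esub> (finprod C (\<lambda>i. e i j) {1..k})"
    and "g 0 = inv\<^bsub>C\<^esub> (finprod C g {1..k})"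
    and "n = Gcd (s ` {0..t})"
    and "G' = {e i j | i j. i \<in> {0..k} \<and> j \<in> {1..t}} \<union> g ` {0..k}"
    and "internal_direct_sum C {1..k} (\<lambda>i. subgroup_generated C (insert (g i) (e i ` {1..t})))"
    and "C \<cong> product_group {1..k}
           (\<lambda>_. product_group {1..t} (\<lambda>_. integer_group) \<times>\<times> integer_mod_group n)"
    and "\<forall>i\<in>{0..k}. e i 0 = g i"
  shows
    "(divisor_theory (zero_sum_monoid C G') G' (\<lambda>B. B) \<and>
      class_group (zero_sum_monoid C G') G' (\<lambda>B. B) \<cong> class_group (red_monoid H) P \<phi> \<and>
      atoms (zero_sum_monoid C G') = U ` {0..k} \<union> V ` {0..t} \<and>
      (\<Sum>i=0..k. U i) = (\<Sum>j=0..t. repeat_mset (s j) (V j)))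
   \<and> (\<forall>B\<in>carrier (zero_sum_monoid C G').
        (\<exists>!xyz. normal_form B xyz) \<and>
        (\<forall>x y z. normal_form B (x, y, z) \<longrightarrow>
           length_set (zero_sum_monoid C G') B =
             (\<lambda>\<nu>. (\<Sum>i=0..k. y i) + (\<Sum>j=0..t. z j)
                    + (\<nu> * (k + 1) + (x - \<nu>) * (\<Sum>j=0..t. s j))) ` {0..x}))
   \<and> (length_system H =
        {(\<lambda>\<nu>. y + \<nu> * (k + 1) + (x - \<nu>) * (\<Sum>j=0..t. s j)) ` {0..x} | y x. True} \<and>
      (\<forall>L\<^sub>1\<in>length_system H. \<forall>L\<^sub>2\<in>length_system H.
         {a + b | a b. a \<in> L\<^sub>1 \<and> b \<in> L\<^sub>2} \<in> length_system H))"
proof -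
  have cancel_H: "comm_monoid_cancel H" and cancel_H': "comm_monoid_cancel H'"
    using \<open>krull_monoid H\<close> \<open>krull_monoid H'\<close> by (auto simp: krull_monoid_def)
  interpret C: comm_group C
    unfolding C_def using comm_monoid_cancel.red_monoid_cancel[OF cancel_H']
      \<open>divisor_theory (red_monoid H') P' \<phi>'\<close>
    by (intro class_group_comm_group) (auto simp: comm_monoid_cancel_def comm_monoid_def)
  \<comment> \<open>From here on \<open>g\<close> is column 0 of \<open>e\<close>, so that the
    \<open>g i\<close> need no separate treatment.\<close>
  have g: "e i 0 = g i" if "i \<le> k" for i using \<open>\<forall>i\<in>{0..k}. e i 0 = g i\<close> that by simp
  have s_pos: "s j \<ge> 1" if "j \<le> t" for j using \<open>\<forall>j\<in>{0..t}. s j \<ge> 1\<close> that by simp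
  have e_pos: "e i j \<in> carrier C" if "1 \<le> i" "i \<le> k" "j \<le> t" for i j
  proof (cases "j = 0")
    case True
    then show ?thesis using \<open>independent_family C {1..k} g\<close> that g[of i] by (simp add: independent_family_def)
  next
    case False
    then show ?thesis
      using \<open>independent_family C ({1..k} \<times> {1..t}) (\<lambda>(i, j). e i j)\<close> that by (auto simp: independent_family_def)
  qed
  have e0: "e 0 j = inv\<^bsub>C\<^esub> (finprod C (\<lambda>i. e i j) {1..k})" if "j \<le> t" for j
  proof (cases "j = 0")
    case True
    have "finprod C (\<lambda>i. e i 0) {1..k} = finprod C g {1..k}"
      using g e_pos[of _ 0] by (intro C.finprod_cong') (auto simp: Pi_iff)
    then show ?thesis using True g[of 0] \<open>g 0 = inv\<^bsub>C\<^esub> (finprod C g {1..k})\<close> by simp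
  next
    case False
    then show ?thesis using \<open>\<forall>j\<in>{1..t}. e 0 j = inv\<^bsub>C\<^esub> (finprod C (\<lambda>i. e i j) {1..k})\<close> that by simp
  qed
  have e: "e i j \<in> carrier C" if "i \<le> k" "j \<le> t" for i j
  proof (cases "i = 0")
    case True
    then show ?thesis using e0[OF that(2)] e_pos that by (auto intro!: C.inv_closed C.finprod_closed)
  qed (use e_pos that in simp)
  have rows: "insert (g i) (e i ` {1..t}) = e i ` {0..t}" if "i \<le> k" for i
  proof -
    have "{0..t} = insert 0 {1..t}" by auto
    then show ?thesis using g[OF that] by simp
  qed
  have G'_eq: "G' = {e i j | i j. i \<le> k \<and> j \<le> t}"
  proof -
    have "g ` {0..k} = (\<lambda>i. e i 0) ` {0..k}" using g by (intro image_cong) auto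
    then have "G' = {e i j | i j. i \<le> k \<and> 1 \<le> j \<and> j \<le> t} \<union> {e i 0 | i. i \<le> k}"
      unfolding \<open>G' = {e i j | i j. i \<in> {0..k} \<and> j \<in> {1..t}} \<union> g ` {0..k}\<close> by auto
    also have "\<dots> = {e i j | i j. i \<le> k \<and> j \<le> t}"
    proof (intro equalityI subsetI)
      fix x assume "x \<in> {e i j | i j. i \<le> k \<and> j \<le> t}"
      then obtain i j where "x = e i j" "i \<le> k" "j \<le> t" by blast
      then show "x \<in> {e i j | i j. i \<le> k \<and> 1 \<le> j \<and> j \<le> t} \<union> {e i 0 | i. i \<le> k}"
        by (cases "j = 0") auto
    qed auto
    finally show ?thesis .
  qed
  have G'_sub: "G' \<subseteq> carrier C" unfolding G'_eq using e by auto
  have "sum_group {1..k} (\<lambda>i. subgroup_generated C (insert (g i) (e i ` {1..t}))) =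
      sum_group {1..k} (\<lambda>i. subgroup_generated C (e i ` {0..t}))"
    using rows by (intro sum_group_cong) simp_all
  then have ids: "internal_direct_sum C {1..k} (\<lambda>i. subgroup_generated C (e i ` {0..t}))"
    using \<open>internal_direct_sum C {1..k} (\<lambda>i. subgroup_generated C (insert (g i) (e i ` {1..t})))\<close>
    by (simp add: internal_direct_sum_def)
  have relations: "finprod C (\<lambda>i. finprod C (\<lambda>j. e i j [^]\<^bsub>C\<^esub> (m i j :: int)) {0..t}) {0..k} = \<one>\<^bsub>C\<^esub> \<longleftrightarrow>
      (\<exists>a c. \<forall>i\<le>k. \<forall>j\<le>t. m i j = a j + c i * int (s j))" for m
  proof -
    have "finprod C (\<lambda>i. finprod C (\<lambda>j. e i j [^]\<^bsub>C\<^esub> (m i j :: int)) {0..t}) {0..k} = \<one>\<^bsub>C\<^esub> \<longleftrightarrow>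
        (\<exists>c. \<forall>i\<in>{1..k}. \<forall>j\<le>t. m i j - m 0 j = c i * int (s j))"
    proof (rule C.grid_relations)
      show "e i 0 [^]\<^bsub>C\<^esub> m \<notin> generate C (e i ` {1..t})" if "i \<in> {1..k}" "0 < m" "m < s 0" for i m
        using \<open>\<forall>i\<in>{1..k}. \<forall>m. 0 < m \<and> m < s 0 \<longrightarrow> g i [^]\<^bsub>C\<^esub> m \<notin> generate C (e i ` {1..t})\<close> that g by simp
      show "inv\<^bsub>C\<^esub> (e i 0 [^]\<^bsub>C\<^esub> s 0) = finprod C (\<lambda>j. e i j [^]\<^bsub>C\<^esub> s j) {1..t}" if "i \<in> {1..k}" for i
        using \<open>\<forall>i\<in>{1..k}. inv\<^bsub>C\<^esub> (g i [^]\<^bsub>C\<^esub> s 0) = finprod C (\<lambda>j. e i j [^]\<^bsub>C\<^esub> s j) {1..t}\<close> that g by simp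
      show "s 0 > 0" using s_pos[of 0] by simp
      show "C.ord (e i j) = 0" if "i \<in> {1..k}" "j \<in> {1..t}" for i j
        using \<open>\<forall>i\<in>{1..k}. \<forall>j\<in>{1..t}. group.ord C (e i j) = 0\<close> that by simp
    qed (use e_pos e0 ids \<open>independent_family C ({1..k} \<times> {1..t}) (\<lambda>(i, j). e i j)\<close> in simp_all)
    also have "\<dots> \<longleftrightarrow> (\<exists>a c. \<forall>i\<le>k. \<forall>j\<le>t. m i j = a j + c i * int (s j))"
    proof
      assume "\<exists>c. \<forall>i\<in>{1..k}. \<forall>j\<le>t. m i j - m 0 j = c i * int (s j)"
      then obtain c where c: "\<And>i j. i \<in> {1..k} \<Longrightarrow> j \<le> t \<Longrightarrow> m i j - m 0 j = c i * int (s j)" by blast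
      \<comment> \<open>Row 0 itself serves as \<open>a\<close>, which forces the coefficient of row
        0 to be 0.\<close>
      have "m i j = m 0 j + (c(0 := 0)) i * int (s j)" if "i \<le> k" "j \<le> t" for i j
        using c[of i j] that by (cases "i = 0") auto
      then show "\<exists>a c. \<forall>i\<le>k. \<forall>j\<le>t. m i j = a j + c i * int (s j)" by blast
    next
      assume "\<exists>a c. \<forall>i\<le>k. \<forall>j\<le>t. m i j = a j + c i * int (s j)"
      then obtain a c where ac: "\<And>i j. i \<le> k \<Longrightarrow> j \<le> t \<Longrightarrow> m i j = a j + c i * int (s j)" by blast
      have "m i j - m 0 j = (c i - c 0) * int (s j)" if "i \<in> {1..k}" "j \<le> t" for i j
        using ac[of i j] ac[of 0 j] that by (simp add: algebra_simps)
      then show "\<exists>c. \<forall>i\<in>{1..k}. \<forall>j\<le>t. m i j - m 0 j = c i * int (s j)" by (intro exI[of _ "\<lambda>i. c i - c 0"]) auto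
    qed
    finally show ?thesis .
  qed
  have inj: "i = i' \<and> j = j'" if ij: "i \<le> k" "i' \<le> k" "j \<le> t" "j' \<le> t" and eq: "e i j = e i' j'" for i i' j j'
  proof -
    \<comment> \<open>The relation coming from \<open>e i j = e i' j'\<close>. A sum of two
      one-entry matrices also makes sense if the two positions coincide, and it fits
      \<open>finprod_grid_add\<close>.\<close>
    let ?m = "\<lambda>p q. (if p = i \<and> q = j then 1 else 0) + (if p = i' \<and> q = j' then -1 else 0 :: int)"
    have "finprod C (\<lambda>i. finprod C (\<lambda>j. e i j [^]\<^bsub>C\<^esub> ?m i j) {0..t}) {0..k} = e i j [^]\<^bsub>C\<^esub> (1::int) \<otimes>\<^bsub>C\<^esub> e i' j' [^]\<^bsub>C\<^esub> (-1::int)"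
    proof -
      have single: "finprod C (\<lambda>i. finprod C (\<lambda>j. e i j [^]\<^bsub>C\<^esub> (if i = p \<and> j = q then b else 0 :: int)) {0..t}) {0..k}
          = e p q [^]\<^bsub>C\<^esub> b" if "p \<le> k" "q \<le> t" for p q b
        using that e by (intro C.finprod_grid_single) auto
      show ?thesis
        using e by (subst C.finprod_grid_add) (simp_all only: single[OF ij(1,3)] single[OF ij(2,4)] atLeastAtMost_iff)
    qed
    also have "\<dots> = \<one>\<^bsub>C\<^esub>"
      unfolding eq using ij e by (simp add: C.int_pow_neg)
    finally obtain a c where "\<forall>p\<le>k. \<forall>q\<le>t. ?m p q = a q + c p * int (s q)" unfolding relations by blast
    then show ?thesis
      using \<open>k \<ge> 1\<close> s_pos \<open>(\<Sum>j=0..t. s j) \<ge> 2\<close> \<open>k + 1 \<noteq> (\<Sum>j=0..t. s j)\<close> ij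
      by (intro unit_matrix_difference_not_proportional[of k t s i i' j j' a c]) auto
  qed
  let ?B = "zero_sum_monoid C G'"
  \<comment> \<open>The group data enter the combinatorics here, through \<open>relations\<close>
    and \<open>inj\<close>.\<close>
  interpret grid e s k t G' "carrier ?B" U V
  proof
    fix B
    show "B \<in> carrier ?B \<longleftrightarrow> set_mset B \<subseteq> G' \<and>
        (\<exists>a c. \<forall>i\<le>k. \<forall>j\<le>t. int (count B (e i j)) = a j + c i * int (s j))"
    proof (cases "set_mset B \<subseteq> G'")
      case True
      have "mset_prod C B = finprod C (\<lambda>i. finprod C (\<lambda>j. e i j [^]\<^bsub>C\<^esub> int (count B (e i j))) {0..t}) {0..k}"
        by (rule C.mset_prod_grid[OF e inj]) (use True in \<open>simp_all only: G'_eq\<close>)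
      with True show ?thesis
        by (simp only: zero_sum_monoid_simps mem_Collect_eq relations simp_thms)
    qed (simp only: zero_sum_monoid_simps mem_Collect_eq simp_thms)
  next
    show "k \<ge> 1" and "(\<Sum>j=0..t. s j) \<ge> 2" by fact+
    show "G' = {e i j | i j. i \<le> k \<and> j \<le> t}" by (rule G'_eq)
    show "s j \<ge> 1" if "j \<le> t" for j using that by (rule s_pos)
    show "i = i' \<and> j = j'" if "i \<le> k" "i' \<le> k" "j \<le> t" "j' \<le> t" "e i j = e i' j'" for i i' j j'
      using that by (rule inj)
  qed (simp_all only: U_def V_def)
  have M_eq: "M = ?B" unfolding M_def by (simp add: zero_sum_monoid_def)
  have class_group: "class_group ?B G' (\<lambda>B. B) \<cong> C"
  proof (rule C.class_group_zero_sum_monoid[OF G'_sub])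
    fix x assume "x \<in> G'"
    then obtain i j where ij: "x = e i j" "i \<le> k" "j \<le> t" by (auto simp: G'_eq)
    \<comment> \<open>\<open>V j\<close> runs through the whole column \<open>j\<close>, so it is a
      zero-sum sequence through each of its classes.\<close>
    have "V j \<in> carrier ?B" using comb_in_Z by (simp only: V_eq_comb[OF ij(3)])
    moreover have "x \<in># V j" using count_V[OF ij(3,2,3)] ij(1) by (simp flip: count_greater_zero_iff)
    ultimately show "\<exists>S. set_mset S \<subseteq> G' \<and> mset_prod C S = \<one>\<^bsub>C\<^esub> \<and> x \<in># S" by auto
  next
    \<comment> \<open>\<open>C\<close> is the direct sum of the row subgroups, each of which is
      generated by members of \<open>G'\<close>.\<close>
    have "c \<in> generate C G'" if c: "c \<in> carrier C" for c
    proof -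
      obtain y where y: "y \<in> Pi\<^sub>E {1..k} (\<lambda>i. carrier (subgroup_generated C (e i ` {0..t})))" "c = finprod C y {1..k}"
        using C.internal_direct_sum_surj[OF ids _ _ c] by auto
      have "y i \<in> generate C G'" if "i \<in> {1..k}" for i
      proof -
        have "carrier C \<inter> e i ` {0..t} \<subseteq> G'" using that unfolding G'_eq by auto blast
        then have "generate C (carrier C \<inter> e i ` {0..t}) \<subseteq> generate C G'" by (rule C.mono_generate)
        then show ?thesis using y(1) that by (auto simp: carrier_subgroup_generated)
      qed
      then show ?thesis
        unfolding y(2) using C.generate_is_subgroup[OF G'_sub] by (intro C.subgroup_finprod_closed)
    qed
    then show "generate C G' = carrier C"
      using C.generate_in_carrier[OF G'_sub] by blast
  qed
  have part1: "divisor_theory ?B G' (\<lambda>B. B) \<and>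
      class_group ?B G' (\<lambda>B. B) \<cong> class_group (red_monoid H) P \<phi> \<and>
      atoms ?B = U ` {0..k} \<union> V ` {0..t} \<and>
      (\<Sum>i=0..k. U i) = (\<Sum>j=0..t. repeat_mset (s j) (V j))"
    using divisor_theory_M[unfolded M_eq] atoms_M[unfolded M_eq] U_sum_eq
      iso_trans[OF class_group \<open>C \<cong> class_group (red_monoid H) P \<phi>\<close>]
    by (intro conjI)
  have nf: "normal_form B (x, y, z) \<longleftrightarrow> y \<in> {0..k} \<rightarrow>\<^sub>E UNIV \<and> z \<in> {0..t} \<rightarrow>\<^sub>E UNIV \<and>
      B = comb y (\<lambda>j. z j + x * s j) \<and> (\<exists>i\<in>{0..k}. y i = 0) \<and> (\<exists>j\<in>{0..t}. z j < s j)" for B x y z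
    by (simp add: normal_form_def comb_shift)
  have ex1: "\<exists>!xyz. normal_form B xyz" if "B \<in> carrier ?B" for B
  proof -
    have "normal_form B = (\<lambda>(x, y, z). y \<in> {0..k} \<rightarrow>\<^sub>E UNIV \<and> z \<in> {0..t} \<rightarrow>\<^sub>E UNIV \<and>
      B = comb y (\<lambda>j. z j + x * s j) \<and> (\<exists>i\<in>{0..k}. y i = 0) \<and> (\<exists>j\<in>{0..t}. z j < s j))"
      using nf by (auto simp: fun_eq_iff)
    then show ?thesis using ex1_normal_form[OF that] by simp
  qed
  have len: "length_set ?B B = (\<lambda>\<nu>. (\<Sum>i=0..k. y i) + (\<Sum>j=0..t. z j)
                    + (\<nu> * (k + 1) + (x - \<nu>) * (\<Sum>j=0..t. s j))) ` {0..x}"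
    if "normal_form B (x, y, z)" for B x y z
  proof -
    from that obtain p q where "p \<le> k" "y p = 0" "q \<le> t" "z q < s q" "B = comb y (\<lambda>j. z j + x * s j)"
      unfolding nf by auto
    then show ?thesis using length_set_comb[unfolded M_eq, of p y q z x] by simp
  qed
  have system: "length_system H =
      {(\<lambda>\<nu>. y + \<nu> * (k + 1) + (x - \<nu>) * (\<Sum>j=0..t. s j)) ` {0..x} | y x. True}"
  proof -
    obtain h where h: "h \<in> iso H' ?B" using \<open>H' \<cong> ?B\<close> by (auto simp: is_iso_def)
    have decomp: "length_system H = {(+) (size w) ` length_set ?B b | w b. set_mset w \<subseteq> P\<^sub>0 \<and> b \<in> carrier ?B}"
      using M_cancel[unfolded M_eq]
      by (rule length_system_decomposition[OF cancel_H cancel_H' _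
          \<open>(\<lambda>(u, z, a). u \<otimes>\<^bsub>H\<^esub> (mset_prod H z \<otimes>\<^bsub>H\<^esub> a)) \<in> iso (units_of H \<times>\<times> free_monoid P\<^sub>0 \<times>\<times> H') H\<close> h])
    show ?thesis
    proof (intro equalityI subsetI)
      fix L assume "L \<in> length_system H"
      then obtain w :: "'a multiset" and b where L: "L = (+) (size w) ` length_set ?B b" "b \<in> carrier ?B" unfolding decomp by blast
      obtain x y z where "normal_form b (x, y, z)" using ex1[OF L(2)] by (metis surj_pair)
      \<comment> \<open>The number of primes and the exponents of the normal form enter only as an
        additive constant, so they merge into one parameter.\<close>
      then have "L = (\<lambda>\<nu>. (size w + (\<Sum>i=0..k. y i) + (\<Sum>j=0..t. z j)) + \<nu> * (k + 1) + (x - \<nu>) * (\<Sum>j=0..t. s j)) ` {0..x}"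
        unfolding L(1) by (simp add: len image_image add.assoc)
      then show "L \<in> {(\<lambda>\<nu>. y + \<nu> * (k + 1) + (x - \<nu>) * (\<Sum>j=0..t. s j)) ` {0..x} | y x. True}" by blast
    next
      fix L assume "L \<in> {(\<lambda>\<nu>. y + \<nu> * (k + 1) + (x - \<nu>) * (\<Sum>j=0..t. s j)) ` {0..x} | y x. True}"
      then obtain y x where L: "L = (\<lambda>\<nu>. y + \<nu> * (k + 1) + (x - \<nu>) * (\<Sum>j=0..t. s j)) ` {0..x}" by blast
      \<comment> \<open>A prescribed constant \<open>y\<close> is realized by \<open>y\<close>
        copies of \<open>U 1\<close>, which exists as \<open>k \<ge> 1\<close>. Row 0 keeps exponent
        0, and \<open>z = 0\<close> stays below \<open>s 0\<close>. The summand \<open>0 +\<close>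
        matches the form of \<open>length_set_comb\<close>.\<close>
      let ?y = "\<lambda>i. if i = 1 then y else 0" and ?b = "comb (\<lambda>i. if i = 1 then y else 0) (\<lambda>j. 0 + x * s j)"
      have "(\<Sum>i=0..k. ?y i) = y" using \<open>k \<ge> 1\<close> by (simp add: sum.delta)
      then have "L = length_set ?B ?b"
        using length_set_comb[unfolded M_eq, of 0 ?y 0 "\<lambda>_. 0" x] s_pos[of 0] L by (simp add: add.assoc)
      then have "L = (+) (size ({#} :: 'a multiset)) ` length_set ?B ?b" by simp
      then show "L \<in> length_system H" unfolding decomp using comb_in_Z[of ?y "\<lambda>j. 0 + x * s j"]
        by (intro CollectI exI[of _ "{#}"] exI[of _ ?b] conjI) (simp_all del: zero_sum_monoid_simps)
    qed
  qed
  have additive: "{a + b | a b. a \<in> L\<^sub>1 \<and> b \<in> L\<^sub>2} \<in> length_system H"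
    if in_system: "L\<^sub>1 \<in> length_system H" "L\<^sub>2 \<in> length_system H" for L\<^sub>1 L\<^sub>2
  proof -
    let ?L = "\<lambda>y x. (\<lambda>\<nu>. y + \<nu> * (k + 1) + (x - \<nu>) * (\<Sum>j=0..t. s j)) ` {0..x}"
    obtain y1 x1 y2 x2 where L: "L\<^sub>1 = ?L y1 x1" "L\<^sub>2 = ?L y2 x2"
      using in_system unfolding system by blast
    have "{a + b | a b. a \<in> L\<^sub>1 \<and> b \<in> L\<^sub>2} = ?L (y1 + y2) (x1 + x2)"
      unfolding L by (rule arithmetical_sumset)
    then show ?thesis unfolding system by blast
  qed
  show ?thesis
    by (rule conjI[OF part1], intro conjI ballI allI impI)
      (erule ex1, erule len, rule system, erule (1) additive)
qed

end
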